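(* Let $\mathcal{P}(X,U)$ be a system of $n$ linear differential polynomial parametric equations $x_i=P_i(U)$, $i=1,\dots,n$, in $n-1$ differential parameters $U=\{u_1,\dots,u_{n-1}\}$ with coefficients in $\mathbb{K}$, with implicit ideal $\mathrm{ID}$ and associated differential polynomials $F_1,\dots,F_n$ and $H_1,\dots,H_n$. If the linear complete differential homogeneous resultant $\partial\mathrm{CRes}^h(H_1,\dots,H_n)$ is nonzero, then $\mathrm{ID}$ has dimension $n-1$ and $$\partial\mathrm{CRes}(F_1,\dots,F_n)(X)=0$$ is the implicit equation of $\mathcal{P}(X,U)$; that is, $\partial\mathrm{CRes}(F_1,\dots,F_n)\in\mathbb{K}\{X\}$ is a characteristic polynomial of $\mathrm{ID}$.
   Context: Setting. $\mathbb{K}$ is an ordinary differential field with derivation $\partial$, $n\ge 2$, $X=\{x_1,\dots,x_n\}$ and $U=\{u_1,\dots,u_{n-1}\}$ are sets of differential indeterminates over $\mathbb{K}$; $x_{ik}=\partial^k x_i$, $u_{jk}=\partial^k u_j$. $\mathbb{K}\{X\}$, $\mathbb{K}\{U\}$ are the rings of differential polynomials and $\mathbb{K}[\partial]$ is the ring of linear differential operators. A system of linear DPPEs $\mathcal{P}(X,U)$ is $x_i=P_i(U)$, $i=1,\dots,n$, with $P_i\in\mathbb{K}\{U\}$ of degree at most $1$, not all in $\mathbb{K}$. Write $P_i=a_i-\sum_{j=1}^{n-1}\mathcal{L}_{ij}(u_j)$ with $a_i\in\mathbb{K}$, $\mathcal{L}_{ij}\in\mathbb{K}[\partial]$. Put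 $H_i(U)=\sum_j\mathcal{L}_{ij}(u_j)$ and $F_i(X,U)=x_i-a_i+H_i(U)$. Standing assumption: for each $j$ there is $i$ with $\mathcal{L}_{ij}\ne0$. For a differential polynomial $P$ and $y\in X\cup U$, $\mathrm{ord}(P,y)$ is the order of $P$ in $y$, and is $-1$ if no derivative of $y$ (including $y$) occurs in $P$. $o_i\ge 0$ is the order of $F_i$ (equal to $\max_j\mathrm{ord}(H_i,u_j)$ if $H_i\neq0$, and $0$ if $H_i=0$), and $N=\sum_{i=1}^n o_i$. Implicit ideal and equation. $\mathrm{ID}=\{f\in\mathbb{K}\{X\}: f(P_1(U),\dots,P_n(U))=0\}$, a prime differential ideal; its (differential) dimension is $n-|\mathcal{C}|$ where $\mathcal{C}$ is a characteristic set of $\mathrm{ID}$ (in the sense of Ritt–Kolchin). If the dimension is $n-1$, then $\mathcal{C}=\{A\}$ with $A$ an irreducible differential polynomial, called a characteristic polynomial of $\mathrm{ID}$ (unique up to a nonzero factor in $\mathbb{K}$), and $A(X)=0$ is called the implicit equation of the system. Linear complete differential resultants. For $j=1,\dots,n-1$ let $\gamma_j=\min\{o_i-\mathrm{ord}(F_i,u_j): i=1,\dots,n\}$ and $\gamma=\sum_{j=1}^{n-1}\gamma_j$. Order the derivatives by $u_{jk}<u_{j'k'}$ iff $k<k'$, or $k=k'$ and $j<j'$. Let $L_\gamma=\sum_{i=1}^n(N-o_i-\gamma+1)$. $M(L_\gamma)$ is the $L_\gamma\times L_\gamma$ matrix over $\mathbb{K}\{X\}$ whose rows are the coefficients of the polynomials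 $\partial^{N-o_i-\gamma}F_i,\dots,\partial F_i,F_i$ (in this order, for $i=1$, then $i=2$, ..., $i=n$), viewed as polynomials of degree at most one in the $L_\gamma-1$ variables $\{u_{jk}: 1\le j\le n-1,\ 0\le k\le N-\gamma_j-\gamma\}$ with coefficients in $\mathbb{K}\{X\}$; columns are indexed by these variables in decreasing order, followed by a last column holding the terms free of $U$. Then $\partial\mathrm{CRes}(F_1,\dots,F_n)=\det M(L_\gamma)$ (this is Macaulay's resultant of that set of polynomials). Let $L_\gamma^h=\sum_{i=1}^n(N-o_i-\gamma)$. $M(L_\gamma^h)$ is the $L_\gamma^h\times L_\gamma^h$ matrix over $\mathbb{K}$ whose rows are the coefficients of $\partial^{N-o_i-\gamma-1}H_i,\dots,\partial H_i,H_i$ (for $i=1,\dots,n$; no rows for $i$ if $N-o_i-\gamma=0$) in the variables $\{u_{jk}: 1\le j\le n-1,\ 0\le k\le N-\gamma_j-\gamma-1\}$ taken in decreasing order. Then $\partial\mathrm{CRes}^h(H_1,\dots,H_n)=\det M(L_\gamma^h)$.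
   Formalization: Two conditions are added: o_i+γ ≤ N for all i (so that the matrices exist), and either γ_j+γ < N for all j or ∂CRes(F_1,…,F_n) ≠ 0; without the latter the claim fails, e.g. n=4, H_1=u_1, H_2=H_3=H_4=u_1'+u_2+u_3. *)

theory Defs
  imports
    "HOL-Library.Poly_Mapping"
    "HOL-Computational_Algebra.Polynomial_Factorial"
    "Jordan_Normal_Form.Determinant"
begin

section \<open>Differential polynomials\<close>

text \<open>
  The pair \<open>(i, k)\<close> stands for the \<open>k\<close>-th derivative of the \<open>i\<close>-th differential indeterminate.
  A differential polynomial is a polynomial in these derivatives, i.e. an element of the monoid
  algebra over the finitely supported exponent functions. The coefficients form an arbitrary
  commutative ring, so that \<open>K{X}\<close> and \<open>K{U}\<close> have type \<open>'k dpoly\<close>, while \<open>K{X,U}\<close>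
  is \<open>K{X}{U}\<close>, of type \<open>'k dpoly dpoly\<close>: the outer level is \<open>U\<close>, the coefficients are in \<open>K{X}\<close>.
\<close>

type_synonym 'a dpoly = "((nat \<times> nat) \<Rightarrow>\<^sub>0 nat) \<Rightarrow>\<^sub>0 'a"

definition derivation :: "('a::comm_ring_1 \<Rightarrow> 'a) \<Rightarrow> bool" where
  "derivation d \<longleftrightarrow> (\<forall>a b. d (a + b) = d a + d b) \<and> (\<forall>a b. d (a * b) = d a * b + a * d b)"

definition dp_const :: "'a::zero \<Rightarrow> 'a dpoly" where
  "dp_const c = Poly_Mapping.single 0 c"

definition dp_var :: "nat \<times> nat \<Rightarrow> 'a::zero_neq_one dpoly" where
  "dp_var v = Poly_Mapping.single (Poly_Mapping.single v 1) 1"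

definition dp_vars :: "'a::zero dpoly \<Rightarrow> (nat \<times> nat) set" where
  "dp_vars p = (\<Union>m\<in>Poly_Mapping.keys p. Poly_Mapping.keys m)"

definition dpolys :: "nat set \<Rightarrow> 'a::zero dpoly set" where
  "dpolys S = {p. dp_vars p \<subseteq> S \<times> UNIV}"

text \<open>
  The derivation of the ring of differential polynomials that extends the derivation \<open>d\<close> of
  the coefficients and sends \<open>(i, k)\<close> to \<open>(i, k + 1)\<close>: on a term \<open>c * m\<close> it is
  \<open>d c * m + (\<Sum>v. c * e\<^sub>v * (m / v) * v')\<close> with \<open>e\<^sub>v\<close> the exponent of \<open>v\<close> in \<open>m\<close>.
\<close>

definition dp_deriv :: "('a::comm_ring_1 \<Rightarrow> 'a) \<Rightarrow> 'a dpoly \<Rightarrow> 'a dpoly" where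
  "dp_deriv d p = (\<Sum>m\<in>Poly_Mapping.keys p.
     Poly_Mapping.single m (d (Poly_Mapping.lookup p m)) +
     (\<Sum>v\<in>Poly_Mapping.keys m.
        Poly_Mapping.single
          (m - Poly_Mapping.single v 1 + Poly_Mapping.single (fst v, Suc (snd v)) 1)
          (of_nat (Poly_Mapping.lookup m v) * Poly_Mapping.lookup p m)))"

definition dp_ord :: "'a::zero dpoly \<Rightarrow> nat \<Rightarrow> int" where
  "dp_ord p j = (if \<exists>k. (j, k) \<in> dp_vars p then int (Max {k. (j, k) \<in> dp_vars p}) else - 1)"

text \<open>
  A linear differential operator \<open>\<Sum>k. c\<^sub>k \<partial>\<^sup>k\<close> is represented by its coefficient sequence, stored
  as a \<open>poly\<close>. The (commutative) multiplication of \<open>poly\<close> is not used.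
\<close>

definition dop_apply :: "('a::comm_ring_1 \<Rightarrow> 'a) \<Rightarrow> 'a poly \<Rightarrow> 'a dpoly \<Rightarrow> 'a dpoly" where
  "dop_apply d l p = (\<Sum>k\<le>Polynomial.degree l. dp_const (poly.coeff l k) * (dp_deriv d ^^ k) p)"

definition dp_subst :: "('a::comm_ring_1 \<Rightarrow> 'a) \<Rightarrow> (nat \<Rightarrow> 'a dpoly) \<Rightarrow> 'a dpoly \<Rightarrow> 'a dpoly" where
  "dp_subst d P f = (\<Sum>m\<in>Poly_Mapping.keys f. dp_const (Poly_Mapping.lookup f m) *
     (\<Prod>(i, k)\<in>Poly_Mapping.keys m. ((dp_deriv d ^^ k) (P i)) ^ Poly_Mapping.lookup m (i, k)))"

definition implicit_ideal ::
  "('k::comm_ring_1 \<Rightarrow> 'k) \<Rightarrow> nat \<Rightarrow> (nat \<Rightarrow> 'k dpoly) \<Rightarrow> 'k dpoly set" where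
  "implicit_ideal d n P = {f \<in> dpolys {1..n}. dp_subst d P f = 0}"

section \<open>Characteristic sets\<close>

text \<open>A ranking of the derivatives of the indeterminates with indices \<open>1..n\<close>, as a strict order.\<close>

definition ranking :: "nat \<Rightarrow> (nat \<times> nat \<Rightarrow> nat \<times> nat \<Rightarrow> bool) \<Rightarrow> bool" where
  "ranking n lt \<longleftrightarrow>
     (let D = {1..n} \<times> (UNIV :: nat set) in
       (\<forall>v\<in>D. \<not> lt v v) \<and>
       (\<forall>u\<in>D. \<forall>v\<in>D. \<forall>w\<in>D. lt u v \<longrightarrow> lt v w \<longrightarrow> lt u w) \<and>
       (\<forall>v\<in>D. \<forall>w\<in>D. v \<noteq> w \<longrightarrow> lt v w \<or> lt w v) \<and>
       (\<forall>v\<in>D. lt v (fst v, Suc (snd v))) \<and>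
       (\<forall>v\<in>D. \<forall>w\<in>D. lt v w \<longrightarrow> lt (fst v, Suc (snd v)) (fst w, Suc (snd w))))"

definition leader :: "(nat \<times> nat \<Rightarrow> nat \<times> nat \<Rightarrow> bool) \<Rightarrow> 'a::zero dpoly \<Rightarrow> nat \<times> nat" where
  "leader lt f = (THE v. v \<in> dp_vars f \<and> (\<forall>w\<in>dp_vars f. w \<noteq> v \<longrightarrow> lt w v))"

definition dp_deg :: "'a::zero dpoly \<Rightarrow> nat \<times> nat \<Rightarrow> nat" where
  "dp_deg f v = Max (insert 0 ((\<lambda>m. Poly_Mapping.lookup m v) ` Poly_Mapping.keys f))"

definition rank_less ::
  "(nat \<times> nat \<Rightarrow> nat \<times> nat \<Rightarrow> bool) \<Rightarrow> 'a::zero dpoly \<Rightarrow> 'a dpoly \<Rightarrow> bool" where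
  "rank_less lt f g \<longleftrightarrow> lt (leader lt f) (leader lt g) \<or>
     leader lt f = leader lt g \<and> dp_deg f (leader lt f) < dp_deg g (leader lt g)"

definition rank_eq ::
  "(nat \<times> nat \<Rightarrow> nat \<times> nat \<Rightarrow> bool) \<Rightarrow> 'a::zero dpoly \<Rightarrow> 'a dpoly \<Rightarrow> bool" where
  "rank_eq lt f g \<longleftrightarrow>
     leader lt f = leader lt g \<and> dp_deg f (leader lt f) = dp_deg g (leader lt g)"

text \<open>\<open>f\<close> is reduced with respect to \<open>g\<close>.\<close>

definition reduced_wrt ::
  "(nat \<times> nat \<Rightarrow> nat \<times> nat \<Rightarrow> bool) \<Rightarrow> 'a::zero dpoly \<Rightarrow> 'a dpoly \<Rightarrow> bool" where
  "reduced_wrt lt f g \<longleftrightarrow>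
     (\<forall>k > snd (leader lt g). (fst (leader lt g), k) \<notin> dp_vars f) \<and>
     dp_deg f (leader lt g) < dp_deg g (leader lt g)"

text \<open>
  Autoreduced sets are listed in order of increasing rank. No element lies in the ground ring.
  The empty list is allowed (it is the characteristic set of the zero ideal).
\<close>

definition autoreduced_in ::
  "(nat \<times> nat \<Rightarrow> nat \<times> nat \<Rightarrow> bool) \<Rightarrow> 'a::zero dpoly set \<Rightarrow> 'a dpoly list \<Rightarrow> bool" where
  "autoreduced_in lt I As \<longleftrightarrow>
     set As \<subseteq> I \<and> (\<forall>f\<in>set As. dp_vars f \<noteq> {}) \<and> sorted_wrt (rank_less lt) As \<and>
     (\<forall>f\<in>set As. \<forall>g\<in>set As. f \<noteq> g \<longrightarrow> reduced_wrt lt f g)"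

text \<open>Ritt's comparison: the first difference in rank decides, and proper extensions are lower.\<close>

definition chain_lower ::
  "(nat \<times> nat \<Rightarrow> nat \<times> nat \<Rightarrow> bool) \<Rightarrow> 'a::zero dpoly list \<Rightarrow> 'a dpoly list \<Rightarrow> bool" where
  "chain_lower lt As Bs \<longleftrightarrow>
     (\<exists>k. k < length As \<and> k < length Bs \<and>
        (\<forall>i<k. rank_eq lt (As ! i) (Bs ! i)) \<and> rank_less lt (As ! k) (Bs ! k)) \<or>
     length Bs < length As \<and> (\<forall>i<length Bs. rank_eq lt (As ! i) (Bs ! i))"

definition characteristic_set ::
  "(nat \<times> nat \<Rightarrow> nat \<times> nat \<Rightarrow> bool) \<Rightarrow> 'a::zero dpoly set \<Rightarrow> 'a dpoly set \<Rightarrow> bool" where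
  "characteristic_set lt I C \<longleftrightarrow>
     (\<exists>As. set As = C \<and> autoreduced_in lt I As \<and>
        (\<forall>Bs. autoreduced_in lt I Bs \<longrightarrow> \<not> chain_lower lt Bs As))"

text \<open>The dimension is \<open>n - card C\<close>, for every characteristic set \<open>C\<close> and every ranking.\<close>

definition has_diff_dim :: "nat \<Rightarrow> 'a::zero dpoly set \<Rightarrow> nat \<Rightarrow> bool" where
  "has_diff_dim n I e \<longleftrightarrow>
     (\<exists>lt C. ranking n lt \<and> characteristic_set lt I C) \<and>
     (\<forall>lt C. ranking n lt \<longrightarrow> characteristic_set lt I C \<longrightarrow> card C \<le> n \<and> e = n - card C)"

text \<open>
  Irreducibility is stated in the polynomial ring in all derivatives \<open>(i, k)\<close>. Over a field it is the
  same as irreducibility in the subring \<open>dpolys {1..n}\<close>, because that subring is closed under divisors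
  of its nonzero elements.
\<close>

definition characteristic_polynomial :: "nat \<Rightarrow> 'k::field dpoly set \<Rightarrow> 'k dpoly \<Rightarrow> bool" where
  "characteristic_polynomial n I A \<longleftrightarrow>
     A \<in> dpolys {1..n} \<and> irreducible A \<and>
     (\<forall>lt. ranking n lt \<longrightarrow> characteristic_set lt I {A})"

section \<open>Linear complete differential resultants\<close>

definition lin_H ::
  "('k::comm_ring_1 \<Rightarrow> 'k) \<Rightarrow> nat \<Rightarrow> (nat \<Rightarrow> nat \<Rightarrow> 'k poly) \<Rightarrow> nat \<Rightarrow> 'k dpoly" where
  "lin_H d n l i = (\<Sum>j = 1..n - 1. dop_apply d (l i j) (dp_var (j, 0)))"

text \<open>\<open>F\<^sub>i = x\<^sub>i - a\<^sub>i + H\<^sub>i\<close> as an element of \<open>K{X}{U}\<close>.\<close>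

definition lin_F ::
  "('k::comm_ring_1 \<Rightarrow> 'k) \<Rightarrow> nat \<Rightarrow> (nat \<Rightarrow> 'k) \<Rightarrow> (nat \<Rightarrow> nat \<Rightarrow> 'k poly) \<Rightarrow> nat \<Rightarrow> 'k dpoly dpoly" where
  "lin_F d n a l i =
     dp_const (dp_var (i, 0) - dp_const (a i)) + Poly_Mapping.map dp_const (lin_H d n l i)"

text \<open>The order of an element of \<open>K{X}{U}\<close> in all of \<open>X\<close> and \<open>U\<close>.\<close>

definition total_ord :: "'k::zero dpoly dpoly \<Rightarrow> nat" where
  "total_ord f =
     Max (snd ` (dp_vars f \<union> (\<Union>m\<in>Poly_Mapping.keys f. dp_vars (Poly_Mapping.lookup f m))))"

definition res_N :: "nat \<Rightarrow> (nat \<Rightarrow> 'k::zero dpoly dpoly) \<Rightarrow> nat" where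
  "res_N n F = (\<Sum>i = 1..n. total_ord (F i))"

text \<open>The minimum is nonnegative for the \<open>F\<^sub>i\<close> considered, because \<open>total_ord\<close> bounds \<open>dp_ord\<close>.\<close>

definition gam :: "nat \<Rightarrow> (nat \<Rightarrow> 'k::zero dpoly dpoly) \<Rightarrow> nat \<Rightarrow> nat" where
  "gam n F j = nat (Min ((\<lambda>i. int (total_ord (F i)) - dp_ord (F i) j) ` {1..n}))"

definition gam_sum :: "nat \<Rightarrow> (nat \<Rightarrow> 'k::zero dpoly dpoly) \<Rightarrow> nat" where
  "gam_sum n F = (\<Sum>j = 1..n - 1. gam n F j)"

text \<open>
  \<open>(j, k)\<close> with \<open>1 \<le> j \<le> n - 1\<close> and \<open>k + gam j + gam_sum + e \<le> N\<close>, in decreasing order, where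
  \<open>(j, k)\<close> is below \<open>(j', k')\<close> iff \<open>k < k'\<close>, or \<open>k = k'\<close> and \<open>j < j'\<close>. The offset \<open>e\<close> is \<open>0\<close> for the
  complete resultant and \<open>1\<close> for the homogeneous one.
\<close>

definition res_cols :: "nat \<Rightarrow> (nat \<Rightarrow> 'k::zero dpoly dpoly) \<Rightarrow> nat \<Rightarrow> (nat \<times> nat) list" where
  "res_cols n F e = concat (map (\<lambda>k. map (\<lambda>j. (j, k))
     (filter (\<lambda>j. k + gam n F j + gam_sum n F + e \<le> res_N n F) (rev [1..<n])))
     (rev [0..<Suc (res_N n F)]))"

definition CRes_size :: "nat \<Rightarrow> (nat \<Rightarrow> 'k::zero dpoly dpoly) \<Rightarrow> nat" where
  "CRes_size n F = (\<Sum>i = 1..n. res_N n F - total_ord (F i) - gam_sum n F + 1)"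

definition CRes_rows ::
  "('k::comm_ring_1 \<Rightarrow> 'k) \<Rightarrow> nat \<Rightarrow> (nat \<Rightarrow> 'k dpoly dpoly) \<Rightarrow> 'k dpoly dpoly list" where
  "CRes_rows d n F = concat (map (\<lambda>i. map (\<lambda>k. (dp_deriv (dp_deriv d) ^^ k) (F i))
     (rev [0..<res_N n F - total_ord (F i) - gam_sum n F + 1])) [1..<n + 1])"

definition CRes_mat ::
  "('k::comm_ring_1 \<Rightarrow> 'k) \<Rightarrow> nat \<Rightarrow> (nat \<Rightarrow> 'k dpoly dpoly) \<Rightarrow> 'k dpoly mat" where
  "CRes_mat d n F = mat (CRes_size n F) (CRes_size n F) (\<lambda>(r, c).
     Poly_Mapping.lookup (CRes_rows d n F ! r)
       (if c < CRes_size n F - 1 then Poly_Mapping.single (res_cols n F 0 ! c) 1 else 0))"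

definition CRes :: "('k::comm_ring_1 \<Rightarrow> 'k) \<Rightarrow> nat \<Rightarrow> (nat \<Rightarrow> 'k dpoly dpoly) \<Rightarrow> 'k dpoly" where
  "CRes d n F = det (CRes_mat d n F)"

text \<open>
  For the homogeneous resultant the family \<open>F\<close> only provides the numbers \<open>o\<^sub>i\<close>, \<open>\<gamma>\<^sub>j\<close>, \<open>\<gamma>\<close> and \<open>N\<close>;
  the rows are built from \<open>H\<close>.
\<close>

definition CResh_size :: "nat \<Rightarrow> (nat \<Rightarrow> 'k::zero dpoly dpoly) \<Rightarrow> nat" where
  "CResh_size n F = (\<Sum>i = 1..n. res_N n F - total_ord (F i) - gam_sum n F)"

definition CResh_rows ::
  "('k::comm_ring_1 \<Rightarrow> 'k) \<Rightarrow> nat \<Rightarrow> (nat \<Rightarrow> 'k dpoly dpoly) \<Rightarrow> (nat \<Rightarrow> 'k dpoly) \<Rightarrow> 'k dpoly list" where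
  "CResh_rows d n F H = concat (map (\<lambda>i. map (\<lambda>k. (dp_deriv d ^^ k) (H i))
     (rev [0..<res_N n F - total_ord (F i) - gam_sum n F])) [1..<n + 1])"

definition CResh_mat ::
  "('k::comm_ring_1 \<Rightarrow> 'k) \<Rightarrow> nat \<Rightarrow> (nat \<Rightarrow> 'k dpoly dpoly) \<Rightarrow> (nat \<Rightarrow> 'k dpoly) \<Rightarrow> 'k mat" where
  "CResh_mat d n F H = mat (CResh_size n F) (CResh_size n F) (\<lambda>(r, c).
     Poly_Mapping.lookup (CResh_rows d n F H ! r) (Poly_Mapping.single (res_cols n F 1 ! c) 1))"

definition CResh ::
  "('k::comm_ring_1 \<Rightarrow> 'k) \<Rightarrow> nat \<Rightarrow> (nat \<Rightarrow> 'k dpoly dpoly) \<Rightarrow> (nat \<Rightarrow> 'k dpoly) \<Rightarrow> 'k" where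
  "CResh d n F H = det (CResh_mat d n F H)"

end

theory Submission
  imports Defs "HOL-Library.Product_Lexorder"
begin

text \<open>
  Everything happens in the linear world. Write \<open>h (i, k) (j, l)\<close> for the coefficient of
  \<open>u\<^sub>j\<^sub>l\<close> in the \<open>k\<close>-th derivative of \<open>H\<^sub>i\<close>, and call a finitely supported vector \<open>y\<close> with
  \<open>\<Sum>v. y v * h v w = 0\<close> for all \<open>w\<close> a relation. Expanding the resultant along its last
  column, whose entries are the derivatives of the \<open>x\<^sub>i - a\<^sub>i\<close>, gives \<open>\<Sum>(i, k). \<kappa> (i, k) *
  \<partial>\<^sup>k (x\<^sub>i - a\<^sub>i)\<close> with cofactors \<open>\<kappa>\<close> in \<open>K\<close>, and \<open>\<kappa>\<close> is a relation. So the resultant is a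
  polynomial of degree at most one that lies in the implicit ideal. The point is that it
  is a generator of the module of all relations over the ring of differential operators.

  The matrices are stairs: if \<open>m\<^sub>i = N - o\<^sub>i - \<gamma>\<close> and \<open>q\<^sub>j = N - \<gamma>\<^sub>j - \<gamma>\<close>, then \<open>h (i, k)
  (j, l) = 0\<close> as soon as \<open>k - m\<^sub>i < l - q\<^sub>j\<close>, and on the diagonal \<open>k - m\<^sub>i = l - q\<^sub>j\<close> the
  entry depends on \<open>i\<close> and \<open>j\<close> only. The homogeneous matrix uses the rows \<open>k < m\<^sub>i\<close> and
  the columns \<open>l < q\<^sub>j\<close>, the complete one has one more row for each \<open>i\<close>, one more column
  for each \<open>j\<close>, and the column of the terms in \<open>X\<close>. Three consequences of the nonvanishing
  homogeneous determinant carry the proof. There is no nonzero relation supported on its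
  rows. If every \<open>q\<^sub>j\<close> is positive, the columns of the complete matrix other than the last
  are independent, so that \<open>\<kappa> \<noteq> 0\<close> (\<open>solution_eq_0_on_cols_1\<close>, \<open>border_cofactor_nonzero\<close>);
  in the remaining case \<open>\<kappa> \<noteq> 0\<close> is a hypothesis. And since the homogeneous system can be
  solved for every right-hand side, the top coefficients of any relation are also those of
  a relation on the rows of the complete matrix, hence proportional to those of \<open>\<kappa>\<close>;
  subtracting a multiple of a derivative of \<open>\<kappa>\<close> then shortens the relation
  (\<open>relations_Suc\<close>). Hence the derivatives of \<open>\<kappa>\<close> span all relations, and a relation
  without terms \<open>(i, k')\<close>, \<open>k' \<ge> k\<close>, where \<open>k\<close> is the order of \<open>\<kappa>\<close> in \<open>x\<^sub>i\<close>, must vanish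
  (\<open>relation_avoiding_tail_eq_0\<close>).

  Equivalently, the derivatives of the \<open>P\<^sub>i\<close> outside such a tail have linearly independent
  linear parts, so the substitution \<open>x\<^sub>i \<mapsto> P\<^sub>i\<close> has a left inverse on the polynomials that
  avoid the tail (\<open>dp_eval_affine_injective\<close>): the implicit ideal contains no nonzero such
  polynomial. For every ranking this says that nothing in the ideal is reduced with
  respect to the resultant or of lower rank, i.e. that the resultant alone is a
  characteristic set; the dimension follows. It is irreducible because it has degree one.
\<close>

section \<open>Determinants with a variable last column\<close>

lemma sum_set_conv_nth:
  assumes "distinct xs"
  shows "(\<Sum>x\<in>set xs. f x) = (\<Sum>i<length xs. f (xs ! i))"
  using sum.reindex_bij_betw[OF bij_betw_nth[OF assms refl refl], of f] by simp

lemma sum_mult_indicator: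
  fixes f :: "'x \<Rightarrow> 'a::comm_ring_1"
  assumes "finite S" "p \<in> S"
  shows "(\<Sum>v\<in>S. f v * (if v = p then 1 else 0)) = f p"
    and "(\<Sum>v\<in>S. (if v = p then 1 else 0) * f v) = f p"
proof -
  have eq: "f v * (if v = p then 1 else 0) = (if p = v then f v else 0)"
    "(if v = p then 1 else 0) * f v = (if p = v then f v else 0)" for v
    by auto
  show "(\<Sum>v\<in>S. f v * (if v = p then 1 else 0)) = f p"
    "(\<Sum>v\<in>S. (if v = p then 1 else 0) * f v) = f p"
    unfolding eq using assms by simp_all
qed

text \<open>
  The resultant matrices are given by lists of row and column labels. Indexing kernel vectors by
  the labels instead of by positions keeps the order of the lists out of all later arguments.
\<close>

lemma det_listed_eq_0_iff_column:
  fixes g :: "'x \<Rightarrow> 'y \<Rightarrow> 'k::field"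
  assumes "distinct ys" "length xs = s" "length ys = s"
  shows "det (mat s s (\<lambda>(r, c). g (xs ! r) (ys ! c))) = 0 \<longleftrightarrow>
    (\<exists>z. (\<exists>u\<in>set ys. z u \<noteq> 0) \<and> (\<forall>v\<in>set xs. (\<Sum>u\<in>set ys. g v u * z u) = 0))"
    (is "det ?M = 0 \<longleftrightarrow> ?R")
proof -
  have M: "?M \<in> carrier_mat s s" by simp
  have prod: "(?M *\<^sub>v vec s (\<lambda>c. z (ys ! c))) $ r = (\<Sum>u\<in>set ys. g (xs ! r) u * z u)"
    if "r < s" for z r
    using that assms by (simp add: scalar_prod_def sum_set_conv_nth atLeast0LessThan)
  show ?thesis
  proof
    assume "det ?M = 0"
    then obtain w where w: "w \<in> carrier_vec s" "w \<noteq> 0\<^sub>v s" "?M *\<^sub>v w = 0\<^sub>v s"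
      using det_0_iff_vec_prod_zero_field[OF M] by blast
    define z where "z u = w $ (THE c. c < s \<and> ys ! c = u)" for u
    have z: "z (ys ! c) = w $ c" if "c < s" for c
    proof -
      have "(THE c'. c' < s \<and> ys ! c' = ys ! c) = c"
        by (rule the_equality) (use that assms in \<open>auto simp: nth_eq_iff_index_eq\<close>)
      then show ?thesis by (simp add: z_def)
    qed
    have weq: "vec s (\<lambda>c. z (ys ! c)) = w" using w(1) z by (intro eq_vecI) auto
    obtain c where "c < s" "w $ c \<noteq> 0" using w(1,2) by (metis carrier_vecD eq_vecI index_zero_vec)
    then have "\<exists>u\<in>set ys. z u \<noteq> 0" using z assms(3) by (metis nth_mem)
    moreover have "(\<Sum>u\<in>set ys. g v u * z u) = 0" if "v \<in> set xs" for v
    proof -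
      obtain r where r: "r < s" "xs ! r = v" using \<open>v \<in> set xs\<close> assms(2) by (metis in_set_conv_nth)
      show ?thesis using prod[OF r(1), of z] w(3) r by (simp add: weq)
    qed
    ultimately show ?R by blast
  next
    assume ?R
    then obtain z u where z: "u \<in> set ys" "z u \<noteq> 0"
      "\<forall>v\<in>set xs. (\<Sum>u\<in>set ys. g v u * z u) = 0" by blast
    obtain c where c: "c < s" "ys ! c = u" using z(1) assms by (metis in_set_conv_nth)
    let ?w = "vec s (\<lambda>c. z (ys ! c))"
    have "?w $ c \<noteq> 0" using c z by simp
    then have "?w \<noteq> 0\<^sub>v s" using c(1) by (metis index_zero_vec(1))
    moreover have "?M *\<^sub>v ?w = 0\<^sub>v s"
    proof (rule eq_vecI)
      fix r assume "r < dim_vec (0\<^sub>v s :: 'k vec)"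
      then have r: "r < s" by simp
      then have "xs ! r \<in> set xs" using assms(2) by simp
      then show "(?M *\<^sub>v ?w) $ r = 0\<^sub>v s $ r" using prod[OF r, of z] z(3) r by simp
    qed simp
    moreover have "?w \<in> carrier_vec s" by simp
    ultimately show "det ?M = 0" using det_0_iff_vec_prod_zero_field[OF M] by blast
  qed
qed

lemma det_listed_transpose:
  fixes g :: "'x \<Rightarrow> 'y \<Rightarrow> 'k::comm_ring_1"
  shows "det (mat s s (\<lambda>(r, c). g (xs ! c) (ys ! r))) = det (mat s s (\<lambda>(r, c). g (xs ! r) (ys ! c)))"
proof -
  have "mat s s (\<lambda>(r, c). g (xs ! c) (ys ! r)) = transpose_mat (mat s s (\<lambda>(r, c). g (xs ! r) (ys ! c)))"
    by (intro eq_matI) auto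
  then show ?thesis using det_transpose[of "mat s s (\<lambda>(r, c). g (xs ! r) (ys ! c))" s] by simp
qed

lemma det_listed_eq_0_iff_row:
  fixes g :: "'x \<Rightarrow> 'y \<Rightarrow> 'k::field"
  assumes "distinct xs" "length xs = s" "length ys = s"
  shows "det (mat s s (\<lambda>(r, c). g (xs ! r) (ys ! c))) = 0 \<longleftrightarrow>
    (\<exists>y. (\<exists>v\<in>set xs. y v \<noteq> 0) \<and> (\<forall>u\<in>set ys. (\<Sum>v\<in>set xs. y v * g v u) = 0))"
  using det_listed_eq_0_iff_column[OF assms(1,3,2), of "\<lambda>u v. g v u"]
  by (simp add: det_listed_transpose mult.commute)

lemma det_listed_row_combination:
  fixes g :: "'x \<Rightarrow> 'y \<Rightarrow> 'k::field"
  assumes "distinct xs" "distinct ys" "length xs = s" "length ys = s"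
    and det: "det (mat s s (\<lambda>(r, c). g (xs ! r) (ys ! c))) \<noteq> 0"
  shows "\<exists>z. \<forall>u\<in>set ys. (\<Sum>v\<in>set xs. z v * g v u) = t u"
proof -
  let ?M = "mat s s (\<lambda>(r, c). g (xs ! r) (ys ! c))"
  have M: "?M \<in> carrier_mat s s" by simp
  obtain B where B: "B \<in> carrier_mat s s" and BM: "B * ?M = 1\<^sub>m s"
    using det_non_zero_imp_unit[OF M det, of "()"] by (auto simp: Units_def ring_mat_def)
  let ?t = "vec s (\<lambda>c. t (ys ! c))"
  let ?y = "transpose_mat B *\<^sub>v ?t"
  have "transpose_mat ?M *\<^sub>v ?y = (transpose_mat ?M * transpose_mat B) *\<^sub>v ?t"
    by (rule assoc_mult_mat_vec[symmetric]) (use B in auto)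
  also have "transpose_mat ?M * transpose_mat B = 1\<^sub>m s"
    by (metis B BM M transpose_mult transpose_one)
  finally have eq: "transpose_mat ?M *\<^sub>v ?y = ?t" by simp
  define z where "z v = ?y $ (THE r. r < s \<and> xs ! r = v)" for v
  have z: "z (xs ! r) = ?y $ r" if "r < s" for r
  proof -
    have "(THE r'. r' < s \<and> xs ! r' = xs ! r) = r"
      by (rule the_equality) (use that assms in \<open>auto simp: nth_eq_iff_index_eq\<close>)
    then show ?thesis by (simp add: z_def)
  qed
  have "(\<Sum>v\<in>set xs. z v * g v u) = t u" if u: "u \<in> set ys" for u
  proof -
    obtain c where c: "c < s" "ys ! c = u" using u assms(4) by (metis in_set_conv_nth)
    have dy: "dim_vec ?y = s" using B by simp
    have "(\<Sum>v\<in>set xs. z v * g v u) = (\<Sum>r<s. ?y $ r * g (xs ! r) (ys ! c))"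
      using assms(1,3) z c by (simp add: sum_set_conv_nth)
    also have "\<dots> = (transpose_mat ?M *\<^sub>v ?y) $ c"
      using c(1) dy by (simp add: scalar_prod_def atLeast0LessThan mult.commute del: index_mult_mat_vec)
         (simp add: scalar_prod_def atLeast0LessThan mult.commute)
    also have "\<dots> = t u" using eq c by simp
    finally show ?thesis .
  qed
  then show ?thesis by blast
qed

text \<open>
  The matrix of \<open>g\<close> with one extra last column \<open>w\<close>, labelled by \<open>None\<close>. The map \<open>hm\<close> embeds the ring of
  the entries of \<open>g\<close> into that of \<open>w\<close>: in the resultant, \<open>g\<close> has entries in \<open>K\<close> but \<open>w\<close> in \<open>K{X}\<close>.
\<close>

definition bordered :: "('a \<Rightarrow> 'b) \<Rightarrow> ('x \<Rightarrow> 'y \<Rightarrow> 'a) \<Rightarrow> ('x \<Rightarrow> 'b) \<Rightarrow> 'x \<Rightarrow> 'y option \<Rightarrow> 'b" where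
  "bordered hm g w v u = (case u of Some u' \<Rightarrow> hm (g v u') | None \<Rightarrow> w v)"

definition bordered_mat ::
  "('a \<Rightarrow> 'b) \<Rightarrow> ('x \<Rightarrow> 'y \<Rightarrow> 'a) \<Rightarrow> ('x \<Rightarrow> 'b) \<Rightarrow> 'x list \<Rightarrow> 'y list \<Rightarrow> 'b mat" where
  "bordered_mat hm g w xs ys =
     mat (length xs) (length xs) (\<lambda>(r, c). bordered hm g w (xs ! r) ((map Some ys @ [None]) ! c))"

text \<open>
  The cofactors of the last column do not depend on that column, so they are read off with the
  column \<open>0\<close>.
\<close>

definition border_cofactor :: "('x \<Rightarrow> 'y \<Rightarrow> 'a::comm_ring_1) \<Rightarrow> 'x list \<Rightarrow> 'y list \<Rightarrow> 'x \<Rightarrow> 'a" where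
  "border_cofactor g xs ys v =
     cofactor (bordered_mat id g (\<lambda>_. 0) xs ys) (THE r. r < length xs \<and> xs ! r = v) (length ys)"

lemma det_bordered_mat:
  fixes hm :: "'a::comm_ring_1 \<Rightarrow> 'b::comm_ring_1"
  assumes "comm_ring_hom hm" and "distinct xs" and len: "length xs = Suc (length ys)"
  shows "det (bordered_mat hm g w xs ys) = (\<Sum>v\<in>set xs. w v * hm (border_cofactor g xs ys v))"
proof -
  interpret comm_ring_hom hm by fact
  let ?s = "length xs"
  let ?M = "bordered_mat hm g w xs ys" and ?Z = "bordered_mat id g (\<lambda>_. 0) xs ys"
  have M: "?M \<in> carrier_mat ?s ?s" by (simp add: bordered_mat_def)
  have cof: "cofactor ?M r (length ys) = hm (border_cofactor g xs ys (xs ! r))" if r: "r < ?s" for r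
  proof -
    have "(THE r'. r' < ?s \<and> xs ! r' = xs ! r) = r"
      by (rule the_equality) (use r assms in \<open>auto simp: nth_eq_iff_index_eq\<close>)
    moreover have "mat_delete ?M r (length ys) = map_mat hm (mat_delete ?Z r (length ys))"
      by (intro eq_matI)
        (auto simp: mat_delete_def bordered_mat_def bordered_def len nth_append split: option.splits)
    ultimately show ?thesis
      by (simp add: border_cofactor_def cofactor_def hom_distribs)
  qed
  have "det ?M = (\<Sum>r<?s. ?M $$ (r, length ys) * cofactor ?M r (length ys))"
    by (rule laplace_expansion_column[OF M]) (simp add: len)
  also have "\<dots> = (\<Sum>r<?s. w (xs ! r) * hm (border_cofactor g xs ys (xs ! r)))"
    by (intro sum.cong refl) (simp add: cof, simp add: bordered_mat_def bordered_def len nth_append)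
  finally show ?thesis using assms(2) by (simp add: sum_set_conv_nth)
qed

lemma comm_ring_hom_id': "comm_ring_hom (id :: 'a::comm_ring_1 \<Rightarrow> 'a)"
  by unfold_locales auto

context
  fixes g :: "'x \<Rightarrow> 'y \<Rightarrow> 'k::field" and xs :: "'x list" and ys :: "'y list"
  assumes dist: "distinct xs" "distinct ys" and len: "length xs = Suc (length ys)"
begin

private lemma bordered_cols: "distinct (map Some ys @ [None])" "length (map Some ys @ [None]) = length xs"
  using dist len by (auto simp: distinct_map)

private lemma det_bordered_field:
  "det (bordered_mat id g w xs ys) = (\<Sum>v\<in>set xs. w v * border_cofactor g xs ys v)"
  using det_bordered_mat[OF comm_ring_hom_id' dist(1) len, of g w] by simp

private lemma det_bordered_eq_0_iff_column:
  "det (bordered_mat id g w xs ys) = 0 \<longleftrightarrow>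
    (\<exists>z b. (b \<noteq> 0 \<or> (\<exists>u\<in>set ys. z u \<noteq> 0)) \<and>
      (\<forall>v\<in>set xs. (\<Sum>u\<in>set ys. g v u * z u) + w v * b = 0))" (is "_ \<longleftrightarrow> ?R")
proof -
  have sum: "(\<Sum>u\<in>set (map Some ys @ [None]). bordered id g w v u * z u)
      = (\<Sum>u\<in>set ys. g v u * z (Some u)) + w v * z None" for v z
    by (simp add: bordered_def sum.reindex add.commute)
  have "det (bordered_mat id g w xs ys) = 0 \<longleftrightarrow>
     (\<exists>z. (\<exists>u\<in>set (map Some ys @ [None]). z u \<noteq> 0) \<and>
       (\<forall>v\<in>set xs. (\<Sum>u\<in>set (map Some ys @ [None]). bordered id g w v u * z u) = 0))"
    unfolding bordered_mat_def by (rule det_listed_eq_0_iff_column) (use bordered_cols in auto)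
  also have "\<dots> \<longleftrightarrow> ?R"
  proof
    assume "\<exists>z. (\<exists>u\<in>set (map Some ys @ [None]). z u \<noteq> 0) \<and>
       (\<forall>v\<in>set xs. (\<Sum>u\<in>set (map Some ys @ [None]). bordered id g w v u * z u) = 0)"
    then obtain z where z: "\<exists>u\<in>set (map Some ys @ [None]). z u \<noteq> 0"
       "\<forall>v\<in>set xs. (\<Sum>u\<in>set (map Some ys @ [None]). bordered id g w v u * z u) = 0" by blast
    show ?R
      by (rule exI[of _ "\<lambda>u. z (Some u)"], rule exI[of _ "z None"]) (use z sum in auto)
  next
    assume ?R
    then obtain z b where z: "b \<noteq> 0 \<or> (\<exists>u\<in>set ys. z u \<noteq> 0)"
      "\<forall>v\<in>set xs. (\<Sum>u\<in>set ys. g v u * z u) + w v * b = 0" by blast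
    show "\<exists>z. (\<exists>u\<in>set (map Some ys @ [None]). z u \<noteq> 0) \<and>
       (\<forall>v\<in>set xs. (\<Sum>u\<in>set (map Some ys @ [None]). bordered id g w v u * z u) = 0)"
      by (rule exI[of _ "case_option b z"], unfold sum) (use z in auto)
  qed
  finally show ?thesis .
qed

private lemma det_bordered_eq_0_iff_row:
  "det (bordered_mat id g w xs ys) = 0 \<longleftrightarrow>
    (\<exists>y. (\<exists>v\<in>set xs. y v \<noteq> 0) \<and> (\<forall>u\<in>set ys. (\<Sum>v\<in>set xs. y v * g v u) = 0) \<and>
      (\<Sum>v\<in>set xs. y v * w v) = 0)"
proof -
  have "det (bordered_mat id g w xs ys) = 0 \<longleftrightarrow>
    (\<exists>y. (\<exists>v\<in>set xs. y v \<noteq> 0) \<and>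
      (\<forall>u\<in>set (map Some ys @ [None]). (\<Sum>v\<in>set xs. y v * bordered id g w v u) = 0))"
    unfolding bordered_mat_def by (rule det_listed_eq_0_iff_row) (use dist bordered_cols in auto)
  also have "\<dots> \<longleftrightarrow> (\<exists>y. (\<exists>v\<in>set xs. y v \<noteq> 0) \<and>
      (\<forall>u\<in>set ys. (\<Sum>v\<in>set xs. y v * g v u) = 0) \<and> (\<Sum>v\<in>set xs. y v * w v) = 0)"
    by (intro ex_cong1) (auto simp: bordered_def)
  finally show ?thesis .
qed

text \<open>
  With a column of \<open>g\<close> repeated as last column, the determinant vanishes.
\<close>

lemma border_cofactor_kills_columns:
  assumes u: "u \<in> set ys"
  shows "(\<Sum>v\<in>set xs. border_cofactor g xs ys v * g v u) = 0"
proof -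
  have "det (bordered_mat id g (\<lambda>v. g v u) xs ys) = 0"
    unfolding det_bordered_eq_0_iff_column
    by (rule exI[of _ "\<lambda>u'. if u' = u then 1 else 0"], rule exI[of _ "- 1"])
      (use u in \<open>simp add: sum_mult_indicator\<close>)
  then show ?thesis by (simp add: det_bordered_field mult.commute)
qed

text \<open>
  If the cofactor at \<open>p\<close> is nonzero, then bordering with the unit vector at \<open>p\<close> gives a nonsingular
  matrix; this says that an element of the left kernel of \<open>g\<close> that vanishes at \<open>p\<close> is zero. Subtracting
  a multiple of the cofactors reduces the general case to this one.
\<close>

lemma left_kernel_border_cofactor:
  assumes p: "p \<in> set xs" "border_cofactor g xs ys p \<noteq> 0"
    and y: "\<forall>u\<in>set ys. (\<Sum>v\<in>set xs. y v * g v u) = 0"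
  shows "\<exists>e. \<forall>v\<in>set xs. y v = e * border_cofactor g xs ys v"
proof -
  define w where "w v = (if v = p then 1 else 0 :: 'k)" for v
  define e where "e = y p / border_cofactor g xs ys p"
  define y' where "y' v = y v - e * border_cofactor g xs ys v" for v
  have "det (bordered_mat id g w xs ys) \<noteq> 0"
    using p by (simp add: det_bordered_field w_def sum_mult_indicator)
  moreover have "(\<Sum>v\<in>set xs. y' v * g v u) = 0" if "u \<in> set ys" for u
  proof -
    have "(\<Sum>v\<in>set xs. y' v * g v u) =
        (\<Sum>v\<in>set xs. y v * g v u) - e * (\<Sum>v\<in>set xs. border_cofactor g xs ys v * g v u)"
      by (simp add: y'_def left_diff_distrib sum_subtractf sum_distrib_left mult.assoc)
    then show ?thesis using y border_cofactor_kills_columns that by simp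
  qed
  moreover have "(\<Sum>v\<in>set xs. y' v * w v) = 0"
    using p by (simp add: w_def sum_mult_indicator) (simp add: y'_def e_def)
  ultimately have "\<forall>v\<in>set xs. y' v = 0" unfolding det_bordered_eq_0_iff_row by blast
  then show ?thesis by (auto simp: y'_def)
qed

text \<open>
  If all cofactors vanished, every bordering would be singular. The column \<open>0\<close> then yields a left
  kernel vector \<open>y\<close> with some \<open>y p \<noteq> 0\<close>, the unit vector at \<open>p\<close> yields a right kernel vector, and pairing
  the latter with \<open>y\<close> shows that its last entry is zero: it is a dependency of the columns of \<open>g\<close>.
\<close>

lemma border_cofactor_nonzero:
  assumes indep: "\<And>z. \<forall>v\<in>set xs. (\<Sum>u\<in>set ys. g v u * z u) = 0 \<Longrightarrow> \<forall>u\<in>set ys. z u = 0"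
  shows "\<exists>p\<in>set xs. border_cofactor g xs ys p \<noteq> 0"
proof (rule ccontr)
  assume "\<not> ?thesis"
  then have det0: "det (bordered_mat id g w xs ys) = 0" for w by (simp add: det_bordered_field)
  obtain y p where p: "p \<in> set xs" "y p \<noteq> 0"
    and y: "\<forall>u\<in>set ys. (\<Sum>v\<in>set xs. y v * g v u) = 0"
    using det0[of "\<lambda>_. 0"] unfolding det_bordered_eq_0_iff_row by blast
  define w where "w v = (if v = p then 1 else 0 :: 'k)" for v
  obtain z b where z: "b \<noteq> 0 \<or> (\<exists>u\<in>set ys. z u \<noteq> 0)"
    and eq: "\<forall>v\<in>set xs. (\<Sum>u\<in>set ys. g v u * z u) + w v * b = 0"
    using det0[of w] unfolding det_bordered_eq_0_iff_column by blast
  have "0 = (\<Sum>v\<in>set xs. y v * ((\<Sum>u\<in>set ys. g v u * z u) + w v * b))" using eq by simp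
  also have "\<dots> = (\<Sum>v\<in>set xs. \<Sum>u\<in>set ys. y v * g v u * z u) + (\<Sum>v\<in>set xs. y v * w v * b)"
    by (simp add: distrib_left sum.distrib sum_distrib_left mult.assoc)
  also have "(\<Sum>v\<in>set xs. \<Sum>u\<in>set ys. y v * g v u * z u) = (\<Sum>u\<in>set ys. (\<Sum>v\<in>set xs. y v * g v u) * z u)"
    by (subst sum.swap) (simp add: sum_distrib_right)
  also have "\<dots> = 0" using y by simp
  also have "(\<Sum>v\<in>set xs. y v * w v * b) = y p * b"
    using p by (simp add: w_def sum_mult_indicator flip: sum_distrib_right)
  finally have "b = 0" using p by simp
  then show False using z eq indep[of z] by simp
qed

end

section \<open>Relations between the rows of a staircase system\<close>

text \<open>
  The effect of the derivation on the coefficient vector of a linear form in the derivatives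
  \<open>(i, k)\<close>: \<open>\<partial>(y * x\<^sub>i\<^sub>k) = d y * x\<^sub>i\<^sub>k + y * x\<^sub>i\<^sub>,\<^sub>k\<^sub>+\<^sub>1\<close>.
\<close>

definition shift_deriv :: "('k::comm_ring_1 \<Rightarrow> 'k) \<Rightarrow> (nat \<times> nat \<Rightarrow> 'k) \<Rightarrow> nat \<times> nat \<Rightarrow> 'k" where
  "shift_deriv d y = (\<lambda>(i, k). d (y (i, k)) + (case k of 0 \<Rightarrow> 0 | Suc k' \<Rightarrow> y (i, k')))"

lemma shift_deriv_simps:
  "shift_deriv d y (i, 0) = d (y (i, 0))"
  "shift_deriv d y (i, Suc k) = d (y (i, Suc k)) + y (i, k)"
  by (simp_all add: shift_deriv_def)

lemma derivation_add: "derivation d \<Longrightarrow> d (a + b) = d a + d b"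
  and derivation_mult: "derivation d \<Longrightarrow> d (a * b) = d a * b + a * d b"
  by (simp_all add: derivation_def)

lemma derivation_0: "derivation d \<Longrightarrow> d 0 = 0"
  using derivation_add[of d 0 0] by simp

lemma derivation_1: "derivation d \<Longrightarrow> d 1 = 0"
  using derivation_mult[of d 1 1] by simp

lemma derivation_minus: "derivation d \<Longrightarrow> d (- a) = - d a"
  using derivation_add[of d a "- a"] by (simp add: derivation_0 eq_neg_iff_add_eq_0 add.commute)

lemma derivation_sum: "derivation d \<Longrightarrow> d (sum f S) = (\<Sum>x\<in>S. d (f x))"
  by (induction S rule: infinite_finite_induct) (simp_all add: derivation_0 derivation_add)

text \<open>
  \<open>h (i, k)\<close> is the coefficient vector of the \<open>k\<close>-th derivative of the \<open>i\<close>-th linear form, whose order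
  in \<open>u\<^sub>j\<close> is at most \<open>q j - m i\<close>. The \<open>k\<close>-th derivative for \<open>k < m i + r\<close> therefore only involves the \<open>u\<^sub>j\<^sub>l\<close>
  with \<open>l < q j + r\<close>.
\<close>

locale staircase_system =
  fixes d :: "'k::field \<Rightarrow> 'k" and I J :: "nat set" and m q :: "nat \<Rightarrow> nat"
    and h :: "nat \<times> nat \<Rightarrow> nat \<times> nat \<Rightarrow> 'k"
  assumes deriv: "derivation d" and fin: "finite I" "finite J"
    and h_Suc: "h (i, Suc k) = shift_deriv d (h (i, k))"
    and h_vanish: "\<lbrakk>i \<in> I; j \<in> J; k + q j < l + m i\<rbrakk> \<Longrightarrow> h (i, k) (j, l) = 0"
    and h_outside: "j \<notin> J \<Longrightarrow> h v (j, l) = 0"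
begin

definition rows :: "nat \<Rightarrow> (nat \<times> nat) set" where "rows r = (SIGMA i:I. {..<m i + r})"
definition cols :: "nat \<Rightarrow> (nat \<times> nat) set" where "cols r = (SIGMA j:J. {..<q j + r})"

definition combination :: "(nat \<times> nat) set \<Rightarrow> (nat \<times> nat \<Rightarrow> 'k) \<Rightarrow> nat \<times> nat \<Rightarrow> 'k" where
  "combination S y w = (\<Sum>v\<in>S. y v * h v w)"

text \<open>
  The vector \<open>y\<close> stands for the operators \<open>D\<^sub>i = \<Sum>k. y (i, k) * \<partial>\<^sup>k\<close>, and \<open>combination\<close> computes the coefficients
  of \<open>\<Sum>i. D\<^sub>i H\<^sub>i\<close>. These vanish outside \<open>cols r\<close>, so finitely many columns decide whether \<open>y\<close> is a relation.
\<close>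

definition relations :: "nat \<Rightarrow> (nat \<times> nat \<Rightarrow> 'k) set" where
  "relations r = {y. (\<forall>v. v \<notin> rows r \<longrightarrow> y v = 0) \<and> (\<forall>w. combination (rows r) y w = 0)}"

lemma finite_rows [simp]: "finite (rows r)" and finite_cols [simp]: "finite (cols r)"
  using fin by (auto simp: rows_def cols_def)

lemma rows_mono: "r \<le> s \<Longrightarrow> rows r \<subseteq> rows s"
  by (auto simp: rows_def)

lemma h_off_cols: "v \<in> rows r \<Longrightarrow> w \<notin> cols r \<Longrightarrow> h v w = 0"
proof -
  assume v: "v \<in> rows r" and w: "w \<notin> cols r"
  obtain i k j l where [simp]: "v = (i, k)" "w = (j, l)" by (cases v; cases w)
  show "h v w = 0"
  proof (cases "j \<in> J")
    case True
    then have "k + q j < l + m i" using v w by (auto simp: rows_def cols_def)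
    then show ?thesis using True v by (auto simp: rows_def intro: h_vanish)
  qed (simp add: h_outside)
qed

lemma combination_off_cols: "w \<notin> cols r \<Longrightarrow> combination (rows r) y w = 0"
  unfolding combination_def by (rule sum.neutral) (use h_off_cols in auto)

lemma combination_superset:
  assumes "S \<subseteq> T" "finite T" "\<And>v. v \<in> T - S \<Longrightarrow> y v = 0"
  shows "combination T y w = combination S y w"
  unfolding combination_def by (rule sum.mono_neutral_right) (use assms in auto)

lemma combination_minus_scale:
  "combination S (\<lambda>v. y v - e * z v) w = combination S y w - e * combination S z w"
  by (simp add: combination_def left_diff_distrib sum_subtractf sum_distrib_left mult.assoc)

lemma relations_minus_scale:
  "\<lbrakk>y \<in> relations r; z \<in> relations r\<rbrakk> \<Longrightarrow> (\<lambda>v. y v - e * z v) \<in> relations r"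
  by (simp add: relations_def combination_minus_scale)

text \<open>
  In terms of operators this is \<open>(\<partial> D) H = \<partial> (D H)\<close>. It makes the derivative of a relation a relation.
\<close>

lemma combination_shift_deriv:
  assumes y: "\<And>v. v \<notin> rows r \<Longrightarrow> y v = 0"
  shows "combination (rows (Suc r)) (shift_deriv d y) = shift_deriv d (combination (rows r) y)"
proof
  fix w :: "nat \<times> nat"
  have shiftsum: "(\<Sum>(i, k)\<in>rows (Suc r). (case k of 0 \<Rightarrow> 0 | Suc k' \<Rightarrow> y (i, k')) * h (i, k) w)
      = (\<Sum>(i, k)\<in>rows r. y (i, k) * h (i, Suc k) w)"
  proof -
    have "(\<Sum>(i, k)\<in>rows r. y (i, k) * h (i, Suc k) w)
        = (\<Sum>v\<in>(\<lambda>(i, k). (i, Suc k)) ` rows r.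
            case v of (i, k) \<Rightarrow> (case k of 0 \<Rightarrow> 0 | Suc k' \<Rightarrow> y (i, k')) * h (i, k) w)"
      by (subst sum.reindex) (auto simp: inj_on_def case_prod_beta intro!: sum.cong)
    also have "\<dots> = (\<Sum>(i, k)\<in>rows (Suc r). (case k of 0 \<Rightarrow> 0 | Suc k' \<Rightarrow> y (i, k')) * h (i, k) w)"
    proof (rule sum.mono_neutral_left)
      show "(\<lambda>(i, k). (i, Suc k)) ` rows r \<subseteq> rows (Suc r)" by (auto simp: rows_def)
      show "\<forall>v\<in>rows (Suc r) - (\<lambda>(i, k). (i, Suc k)) ` rows r.
          (case v of (i, k) \<Rightarrow> (case k of 0 \<Rightarrow> 0 | Suc k' \<Rightarrow> y (i, k')) * h (i, k) w) = 0"
      proof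
        fix v assume v: "v \<in> rows (Suc r) - (\<lambda>(i, k). (i, Suc k)) ` rows r"
        obtain i k where [simp]: "v = (i, k)" by (cases v)
        have "k = 0" using v by (cases k) (auto simp: rows_def image_iff)
        then show "(case v of (i, k) \<Rightarrow> (case k of 0 \<Rightarrow> 0 | Suc k' \<Rightarrow> y (i, k')) * h (i, k) w) = 0"
          by simp
      qed
    qed simp
    finally show ?thesis by simp
  qed
  have "combination (rows (Suc r)) (shift_deriv d y) w
      = (\<Sum>v\<in>rows (Suc r). d (y v) * h v w)
        + (\<Sum>(i, k)\<in>rows (Suc r). (case k of 0 \<Rightarrow> 0 | Suc k' \<Rightarrow> y (i, k')) * h (i, k) w)"
    by (simp add: combination_def shift_deriv_def distrib_right sum.distrib case_prod_beta)
  also have "(\<Sum>v\<in>rows (Suc r). d (y v) * h v w) = (\<Sum>v\<in>rows r. d (y v) * h v w)"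
    by (rule sum.mono_neutral_right) (use y rows_mono[of r "Suc r"] in \<open>auto simp: derivation_0[OF deriv]\<close>)
  also have "\<dots> + (\<Sum>(i, k)\<in>rows (Suc r). (case k of 0 \<Rightarrow> 0 | Suc k' \<Rightarrow> y (i, k')) * h (i, k) w)
      = (\<Sum>(i, k)\<in>rows r. d (y (i, k)) * h (i, k) w + y (i, k) * h (i, Suc k) w)"
    using shiftsum by (simp add: sum.distrib case_prod_beta)
  also have "\<dots> = shift_deriv d (combination (rows r) y) w"
    by (cases w; cases "snd w")
      (simp_all add: shift_deriv_def h_Suc combination_def derivation_sum[OF deriv]
        derivation_mult[OF deriv] sum.distrib distrib_left case_prod_beta algebra_simps)
  finally show "combination (rows (Suc r)) (shift_deriv d y) w = shift_deriv d (combination (rows r) y) w" .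
qed

lemma shift_deriv_relations:
  assumes "y \<in> relations r"
  shows "shift_deriv d y \<in> relations (Suc r)"
proof -
  have "combination (rows (Suc r)) (shift_deriv d y) w = 0" for w
    by (subst combination_shift_deriv)
      (use assms in \<open>auto simp: relations_def shift_deriv_def derivation_0[OF deriv] split: prod.splits nat.splits\<close>)
  moreover have "shift_deriv d y v = 0" if "v \<notin> rows (Suc r)" for v
  proof -
    obtain i k where [simp]: "v = (i, k)" by (cases v)
    have y: "y (i, k') = 0" if "Suc k' \<ge> k" for k'
      using assms that \<open>v \<notin> rows (Suc r)\<close> by (auto simp: relations_def rows_def)
    show ?thesis using y by (cases k) (simp_all add: shift_deriv_simps derivation_0[OF deriv])
  qed
  ultimately show ?thesis by (simp add: relations_def)
qed

text \<open>
  The leading coefficient of a linear form is unchanged by differentiation, because the term with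
  the differentiated coefficient has lower order.
\<close>

lemma h_diagonal:
  assumes "i \<in> I" "j \<in> J" "l + m i = k + q j"
  shows "h (i, k + r) (j, l + r) = h (i, k) (j, l)"
proof (induction r)
  case (Suc r)
  have "h (i, k + r) (j, Suc (l + r)) = 0" by (rule h_vanish) (use assms in auto)
  then show ?case using Suc by (simp add: h_Suc shift_deriv_simps derivation_0[OF deriv])
qed simp

text \<open>
  The columns of \<open>rows 1 \<times> cols 1\<close> are independent. The matrix is block triangular, with the small
  matrix as one block and the leading coefficients \<open>h (i, m i) (j, q j)\<close> as the other. A dependency of
  the latter reappears, by \<open>h_diagonal\<close>, among the top columns \<open>q j - 1\<close> of the small matrix, provided
  that these exist.
\<close>

lemma solution_eq_0_on_cols_1:
  assumes small: "\<And>z. \<forall>v\<in>rows 0. (\<Sum>w\<in>cols 0. h v w * z w) = 0 \<Longrightarrow> \<forall>w\<in>cols 0. z w = 0"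
    and q_pos: "\<And>j. j \<in> J \<Longrightarrow> q j > 0"
    and z: "\<forall>v\<in>rows 1. (\<Sum>w\<in>cols 1. h v w * z w) = 0"
  shows "\<forall>w\<in>cols 1. z w = 0"
proof -
  have cols_1: "cols 1 = cols 0 \<union> (\<lambda>j. (j, q j)) ` J" by (auto simp: cols_def)
  have sum_1: "(\<Sum>w\<in>cols 1. h v w * x w) = (\<Sum>w\<in>cols 0. h v w * x w) + (\<Sum>j\<in>J. h v (j, q j) * x (j, q j))"
    for v x unfolding cols_1
    by (subst sum.union_disjoint) (use fin in \<open>auto simp: cols_def sum.reindex inj_on_def\<close>)
  have "\<forall>v\<in>rows 0. (\<Sum>w\<in>cols 0. h v w * z w) = 0"
  proof
    fix v assume v: "v \<in> rows 0"
    have "(\<Sum>j\<in>J. h v (j, q j) * z (j, q j)) = 0"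
      by (rule sum.neutral) (use h_off_cols[OF v] in \<open>auto simp: cols_def\<close>)
    moreover have "v \<in> rows 1" using v rows_mono[of 0 1] by auto
    ultimately show "(\<Sum>w\<in>cols 0. h v w * z w) = 0" using z sum_1[of v z] by simp
  qed
  then have z0: "\<forall>w\<in>cols 0. z w = 0" by (rule small)
  have top: "(\<Sum>j\<in>J. h (i, m i) (j, q j) * z (j, q j)) = 0" if "i \<in> I" for i
  proof -
    have "(i, m i) \<in> rows 1" using that by (simp add: rows_def)
    then show ?thesis using z z0 sum_1[of "(i, m i)" z] by simp
  qed
  define x where "x w = (if Suc (snd w) = q (fst w) then z (fst w, q (fst w)) else 0)" for w
  have x_sum: "(\<Sum>w\<in>cols 0. h v w * x w) = (\<Sum>j\<in>J. h v (j, q j - 1) * z (j, q j))" for v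
  proof -
    have "(\<Sum>j\<in>J. h v (j, q j - 1) * z (j, q j)) = (\<Sum>w\<in>(\<lambda>j. (j, q j - 1)) ` J. h v w * x w)"
      by (subst sum.reindex) (use q_pos in \<open>auto simp: inj_on_def x_def intro!: sum.cong\<close>)
    also have "\<dots> = (\<Sum>w\<in>cols 0. h v w * x w)"
    proof (rule sum.mono_neutral_left)
      show "(\<lambda>j. (j, q j - 1)) ` J \<subseteq> cols 0" using q_pos by (auto simp: cols_def)
      show "\<forall>w\<in>cols 0 - (\<lambda>j. (j, q j - 1)) ` J. h v w * x w = 0"
      proof
        fix w assume "w \<in> cols 0 - (\<lambda>j. (j, q j - 1)) ` J"
        then show "h v w * x w = 0" by (cases w) (auto simp: cols_def x_def image_iff)
      qed
    qed simp
    finally show ?thesis by simp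
  qed
  have "\<forall>v\<in>rows 0. (\<Sum>w\<in>cols 0. h v w * x w) = 0"
  proof
    fix v assume "v \<in> rows 0"
    then obtain i k where v: "v = (i, k)" "i \<in> I" "k < m i" by (auto simp: rows_def)
    show "(\<Sum>w\<in>cols 0. h v w * x w) = 0"
    proof (cases "Suc k = m i")
      case True
      have "h v (j, q j - 1) = h (i, m i) (j, q j)" if j: "j \<in> J" for j
        using h_diagonal[OF v(2) j, of "q j - 1" k 1] True v q_pos[OF j] by simp
      then show ?thesis using top[OF v(2)] by (simp add: x_sum)
    next
      case False
      have "h v (j, q j - 1) = 0" if j: "j \<in> J" for j
        unfolding v(1) by (rule h_vanish[OF v(2) j]) (use False v q_pos[OF j] in auto)
      then show ?thesis by (simp add: x_sum)
    qed
  qed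
  then have x0: "\<forall>w\<in>cols 0. x w = 0" by (rule small)
  have "z (j, q j) = 0" if j: "j \<in> J" for j
  proof -
    have "(j, q j - 1) \<in> cols 0" using j q_pos[OF j] by (simp add: cols_def)
    then show ?thesis using x0 q_pos[OF j] by (auto simp: x_def)
  qed
  then show ?thesis using z0 unfolding cols_1 by auto
qed

end

text \<open>
  This collects what the two determinants provide: \<open>indep\<close> and \<open>solvable\<close> come from the homogeneous
  resultant, and \<open>c\<close> will be the vector of cofactors of the last column of the complete one.
\<close>

locale staircase_syzygy = staircase_system d I J m q h
  for d :: "'k::field \<Rightarrow> 'k" and I J m q h +
  fixes c :: "nat \<times> nat \<Rightarrow> 'k"
  assumes indep: "\<And>y. \<forall>w\<in>cols 0. combination (rows 0) y w = 0 \<Longrightarrow> \<forall>v\<in>rows 0. y v = 0"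
    and solvable: "\<And>t. \<exists>z. \<forall>w\<in>cols 0. combination (rows 0) z w = t w"
    and c_rel: "c \<in> relations 1"
    and c_span: "\<And>y. \<forall>w\<in>cols 1. combination (rows 1) y w = 0 \<Longrightarrow> \<exists>e. \<forall>v\<in>rows 1. y v = e * c v"
begin

lemma relations_0: "y \<in> relations 0 \<Longrightarrow> y v = 0"
  using indep[of y] unfolding relations_def by blast

lemma shift_deriv_pow_c:
  "(shift_deriv d ^^ r) c \<in> relations (Suc r)"
  "i \<in> I \<Longrightarrow> (shift_deriv d ^^ r) c (i, m i + r) = c (i, m i)"
proof (induction r arbitrary: i)
  case 0
  { case 1 show ?case using c_rel by simp next
    case 2 show ?case by simp }
next
  case (Suc r)
  { case 1 show ?case using shift_deriv_relations[OF Suc.IH(1)] by simp next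
    case 2
    have "(i, Suc (m i + r)) \<notin> rows (Suc r)" by (simp add: rows_def)
    then have "(shift_deriv d ^^ r) c (i, Suc (m i + r)) = 0"
      using Suc.IH(1) by (auto simp: relations_def)
    then show ?case using Suc.IH(2)[OF 2] by (simp add: shift_deriv_simps derivation_0[OF deriv]) }
qed

text \<open>
  The top coefficients \<open>t\<close> of a relation annihilate the matrix of leading coefficients. As the small
  system is solvable, \<open>t\<close> extends to a relation on \<open>rows 1\<close>, which is a multiple of \<open>c\<close>. So \<open>t\<close> is a
  multiple of the top coefficients of \<open>c\<close>, which are those of every derivative of \<open>c\<close>.
\<close>

lemma relations_Suc:
  assumes y: "y \<in> relations (Suc r)"
  shows "\<exists>e. (\<lambda>v. y v - e * (shift_deriv d ^^ r) c v) \<in> relations r"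
proof -
  define t where "t i = y (i, m i + r)" for i
  have split: "rows (Suc r) = rows r \<union> (\<lambda>i. (i, m i + r)) ` I" for r
    by (auto simp: rows_def)
  have sum_split: "combination (rows (Suc r)) z w
      = combination (rows r) z w + (\<Sum>i\<in>I. z (i, m i + r) * h (i, m i + r) w)" for r z w
    unfolding combination_def split
    by (subst sum.union_disjoint) (use fin in \<open>auto simp: rows_def sum.reindex inj_on_def\<close>)
  \<comment> \<open>The top column of each block only meets the top rows.\<close>
  have top: "(\<Sum>i\<in>I. t i * h (i, m i) (j, q j)) = 0" if j: "j \<in> J" for j
  proof -
    have "0 = combination (rows (Suc r)) y (j, q j + r)" using y by (simp add: relations_def)
    also have "\<dots> = (\<Sum>i\<in>I. t i * h (i, m i + r) (j, q j + r))"
      using combination_off_cols[of "(j, q j + r)" r y] by (simp add: sum_split cols_def t_def)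
    also have "\<dots> = (\<Sum>i\<in>I. t i * h (i, m i) (j, q j))"
      by (intro sum.cong refl) (simp add: h_diagonal[OF _ j add.commute])
    finally show ?thesis by simp
  qed
  obtain z where z: "\<forall>w\<in>cols 0. combination (rows 0) z w = - (\<Sum>i\<in>I. t i * h (i, m i) w)"
    using solvable[of "\<lambda>w. - (\<Sum>i\<in>I. t i * h (i, m i) w)"] by blast
  \<comment> \<open>The extension of the top coefficients to a relation on the rows with k at most m i.\<close>
  define z' where "z' v = (if v \<in> rows 0 then z v else t (fst v))" for v
  have z'_top: "z' (i, m i) = t i" for i by (simp add: z'_def rows_def)
  have "combination (rows 0) z' w = combination (rows 0) z w" for w
    by (simp add: combination_def z'_def)
  then have z'_comb: "combination (rows 1) z' w
      = combination (rows 0) z w + (\<Sum>i\<in>I. t i * h (i, m i) w)" for w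
    using sum_split[of 0 z' w] by (simp add: z'_top)
  have "combination (rows 1) z' w = 0" if w: "w \<in> cols 1" for w
  proof (cases "w \<in> cols 0")
    case True then show ?thesis using z z'_comb[of w] by simp
  next
    case False
    then obtain j where "w = (j, q j)" "j \<in> J" using w by (auto simp: cols_def less_Suc_eq)
    then show ?thesis using combination_off_cols[OF False] top z'_comb[of w] by simp
  qed
  then obtain e where e: "\<forall>v\<in>rows 1. z' v = e * c v" using c_span by blast
  have te: "t i = e * c (i, m i)" if i: "i \<in> I" for i
  proof -
    have "(i, m i) \<in> rows 1" using i by (simp add: rows_def)
    then show ?thesis using e z'_top by metis
  qed
  define y' where "y' v = y v - e * (shift_deriv d ^^ r) c v" for v
  have y': "y' \<in> relations (Suc r)"
    unfolding y'_def by (rule relations_minus_scale[OF y shift_deriv_pow_c(1)])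
  have off: "y' v = 0" if v: "v \<notin> rows r" for v
  proof (cases "v \<in> rows (Suc r)")
    case True
    then obtain i where "i \<in> I" "v = (i, m i + r)" using v split[of r] by auto
    then show ?thesis using te shift_deriv_pow_c(2) by (simp add: y'_def flip: t_def)
  next
    case False
    then show ?thesis using y' unfolding relations_def by blast
  qed
  have "combination (rows r) y' w = combination (rows (Suc r)) y' w" for w
    by (rule combination_superset[symmetric]) (use off rows_mono[of r "Suc r"] in auto)
  then have "y' \<in> relations r" using y' off by (simp add: relations_def)
  then show ?thesis unfolding y'_def by blast
qed

text \<open>
  In terms of operators, every relation is a left multiple of \<open>c\<close>, and a nonzero left multiple of \<open>c\<close>
  has at least the order of \<open>c\<close> in \<open>x\<^sub>i\<close>. Reducing a relation step by step by multiples of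
  derivatives of \<open>c\<close>, the coefficient at \<open>(i0, k0 + r)\<close> forces the multiplier of the \<open>r\<close>-th derivative
  to be zero.
\<close>

lemma relation_avoiding_tail_eq_0:
  assumes lead: "c (i0, k0) \<noteq> 0" "\<And>k. k > k0 \<Longrightarrow> c (i0, k) = 0"
    and y: "y \<in> relations r" and avoid: "\<And>k. k \<ge> k0 \<Longrightarrow> y (i0, k) = 0"
  shows "y v = 0"
proof -
  have lead_pow: "(shift_deriv d ^^ r) c (i0, k0 + r) = c (i0, k0) \<and>
      (\<forall>k>k0 + r. (shift_deriv d ^^ r) c (i0, k) = 0)" for r
  proof (induction r)
    case (Suc r)
    have "(shift_deriv d ^^ Suc r) c (i0, k) = 0" if "k > k0 + Suc r" for k
      using Suc that by (cases k) (auto simp: shift_deriv_simps derivation_0[OF deriv])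
    then show ?case using Suc by (simp add: shift_deriv_simps derivation_0[OF deriv])
  qed (use lead in auto)
  have bound: "\<forall>k\<ge>k0 + r. y (i0, k) = 0" if "y \<in> relations r" for y r
    using that
  proof (induction r arbitrary: y)
    case 0 then show ?case using relations_0 by blast
  next
    case (Suc r)
    obtain e where e: "(\<lambda>v. y v - e * (shift_deriv d ^^ r) c v) \<in> relations r"
      using relations_Suc[OF Suc.prems] by blast
    show ?case
    proof (intro allI impI)
      fix k assume k: "k \<ge> k0 + Suc r"
      have "y (i0, k) - e * (shift_deriv d ^^ r) c (i0, k) = 0" using Suc.IH[OF e] k by simp
      then show "y (i0, k) = 0" using lead_pow[of r] k by simp
    qed
  qed
  show ?thesis using y avoid
  proof (induction r arbitrary: y)
    case 0 then show ?case using relations_0 by blast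
  next
    case (Suc r)
    obtain e where e: "(\<lambda>v. y v - e * (shift_deriv d ^^ r) c v) \<in> relations r"
      using relations_Suc[OF Suc.prems(1)] by blast
    have "y (i0, k0 + r) - e * (shift_deriv d ^^ r) c (i0, k0 + r) = 0"
      using bound[OF e] by simp
    then have "e = 0" using Suc.prems(2)[of "k0 + r"] lead_pow[of r] lead(1) by simp
    then show ?case using e Suc.IH Suc.prems(2) by simp
  qed
qed

end

section \<open>Evaluation of differential polynomials\<close>

text \<open>
  The ring homomorphism that extends \<open>hm\<close> and sends the variable \<open>v\<close> to \<open>\<phi> v\<close>. The substitution of the
  parametric equations is one instance; its left inverse and the passage to univariate
  polynomials in one chosen variable are others.
\<close>

definition dp_eval :: "('a::comm_ring_1 \<Rightarrow> 'b::comm_ring_1) \<Rightarrow> (nat \<times> nat \<Rightarrow> 'b) \<Rightarrow> 'a dpoly \<Rightarrow> 'b" where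
  "dp_eval hm \<phi> f = (\<Sum>m\<in>Poly_Mapping.keys f. hm (Poly_Mapping.lookup f m) *
     (\<Prod>v\<in>Poly_Mapping.keys m. \<phi> v ^ Poly_Mapping.lookup m v))"

lemma dp_subst_eq_dp_eval:
  "dp_subst d P = dp_eval dp_const (\<lambda>(i, k). (dp_deriv d ^^ k) (P i))"
  by (simp add: fun_eq_iff dp_subst_def dp_eval_def case_prod_beta)

lemma poly_mapping_eq_sum_single:
  "p = (\<Sum>m\<in>Poly_Mapping.keys p. Poly_Mapping.single m (Poly_Mapping.lookup p m))"
proof (rule poly_mapping_eqI)
  fix k
  show "Poly_Mapping.lookup p k =
    Poly_Mapping.lookup (\<Sum>m\<in>Poly_Mapping.keys p. Poly_Mapping.single m (Poly_Mapping.lookup p m)) k"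
    by (cases "k \<in> Poly_Mapping.keys p")
      (auto simp: lookup_sum lookup_single when_def sum.delta' in_keys_iff)
qed

lemma poly_mapping_single_induct [case_names add single]:
  assumes "\<And>p q. Q p \<Longrightarrow> Q q \<Longrightarrow> Q (p + q)" "\<And>m a. Q (Poly_Mapping.single m a)"
  shows "Q (p :: 'x \<Rightarrow>\<^sub>0 'a::comm_monoid_add)"
proof -
  have "Q (\<Sum>m\<in>S. Poly_Mapping.single m (f m))" if "finite S" for S and f :: "'x \<Rightarrow> 'a"
    using that
  proof (induction S rule: finite_induct)
    case empty
    show ?case using assms(2)[of undefined 0] by simp
  qed (use assms in auto)
  then show ?thesis by (subst poly_mapping_eq_sum_single) simp
qed

locale evaluation = comm_ring_hom hm for hm :: "'a::comm_ring_1 \<Rightarrow> 'b::comm_ring_1" +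
  fixes \<phi> :: "nat \<times> nat \<Rightarrow> 'b"
begin

abbreviation "ev \<equiv> dp_eval hm \<phi>"

definition ev_monom :: "(nat \<times> nat \<Rightarrow>\<^sub>0 nat) \<Rightarrow> 'b" where
  "ev_monom m = (\<Prod>v\<in>Poly_Mapping.keys m. \<phi> v ^ Poly_Mapping.lookup m v)"

lemma ev_monom_superset:
  "finite S \<Longrightarrow> Poly_Mapping.keys m \<subseteq> S \<Longrightarrow> ev_monom m = (\<Prod>v\<in>S. \<phi> v ^ Poly_Mapping.lookup m v)"
  unfolding ev_monom_def by (rule prod.mono_neutral_left) (auto simp: in_keys_iff)

lemma ev_monom_add: "ev_monom (m + m') = ev_monom m * ev_monom m'"
proof -
  let ?S = "Poly_Mapping.keys m \<union> Poly_Mapping.keys m'"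
  have "Poly_Mapping.keys (m + m') \<subseteq> ?S" by (rule Poly_Mapping.keys_add)
  then show ?thesis
    by (simp add: ev_monom_superset[of ?S] lookup_add power_add prod.distrib)
qed

lemma ev_monom_0 [simp]: "ev_monom 0 = 1" by (simp add: ev_monom_def)

lemma ev_monom_single [simp]: "ev_monom (Poly_Mapping.single v 1) = \<phi> v" by (simp add: ev_monom_def)

lemma ev_superset:
  assumes "finite S" "Poly_Mapping.keys f \<subseteq> S"
  shows "ev f = (\<Sum>m\<in>S. hm (Poly_Mapping.lookup f m) * ev_monom m)"
  unfolding dp_eval_def ev_monom_def
  by (rule sum.mono_neutral_left) (use assms in \<open>auto simp: in_keys_iff\<close>)

lemma ev_0 [simp]: "ev 0 = 0" by (simp add: dp_eval_def)

lemma ev_add: "ev (f + g) = ev f + ev g"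
proof -
  let ?S = "Poly_Mapping.keys f \<union> Poly_Mapping.keys g"
  have "Poly_Mapping.keys (f + g) \<subseteq> ?S" by (rule Poly_Mapping.keys_add)
  then show ?thesis
    by (simp add: ev_superset[of ?S] lookup_add hom_add distrib_right sum.distrib)
qed

lemma ev_single [simp]: "ev (Poly_Mapping.single m a) = hm a * ev_monom m"
  by (subst ev_superset[of "{m}"]) auto

lemma ev_mult: "ev (f * g) = ev f * ev g"
proof (induction f rule: poly_mapping_single_induct)
  case (add p q) then show ?case by (simp add: distrib_right ev_add)
next
  case (single m a)
  show ?case
  proof (induction g rule: poly_mapping_single_induct)
    case (add p q) then show ?case by (simp add: distrib_left ev_add)
  next
    case (single m' a')
    show ?case by (simp add: mult_single ev_monom_add hom_mult ac_simps)
  qed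
qed

lemma ev_dp_const [simp]: "ev (dp_const c) = hm c" by (simp add: dp_const_def)

lemma ev_dp_var [simp]: "ev (dp_var v) = \<phi> v" using ev_monom_single by (simp add: dp_var_def)

lemma comm_ring_hom_ev: "comm_ring_hom ev"
proof
  have "ev 1 = ev (dp_const 1)" by (simp add: dp_const_def)
  then show "ev 1 = 1" by simp
qed (simp_all add: ev_add ev_mult)

end

lemma hom_dp_eval:
  assumes "comm_ring_hom \<rho>"
  shows "\<rho> (dp_eval hm \<phi> f) = dp_eval (\<rho> \<circ> hm) (\<rho> \<circ> \<phi>) f"
proof -
  interpret comm_ring_hom \<rho> by fact
  show ?thesis by (simp add: dp_eval_def hom_distribs)
qed

lemma comm_ring_hom_dp_const: "comm_ring_hom (dp_const :: 'a::comm_ring_1 \<Rightarrow> 'a dpoly)"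
  by unfold_locales (simp_all add: dp_const_def single_add mult_single)

text \<open>
  Used in the form that an evaluation undoes a substitution as soon as it does so on the
  variables.
\<close>

lemma dp_eval_eq_self:
  assumes "\<And>v. v \<in> dp_vars f \<Longrightarrow> \<phi> v = dp_var v"
  shows "dp_eval dp_const \<phi> f = (f :: 'a::comm_ring_1 dpoly)"
proof -
  have pow: "dp_var v ^ e = (Poly_Mapping.single (Poly_Mapping.single v e) 1 :: 'a dpoly)" for v e
    by (induction e) (simp_all add: dp_var_def mult_single single_add[symmetric])
  have prod: "(\<Prod>v\<in>S. Poly_Mapping.single (Poly_Mapping.single v (e v)) 1)
      = (Poly_Mapping.single (\<Sum>v\<in>S. Poly_Mapping.single v (e v)) 1 :: 'a dpoly)" for S :: "(nat \<times> nat) set" and e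
    by (induction S rule: infinite_finite_induct) (simp_all add: mult_single)
  have mono: "dp_const a * (\<Prod>v\<in>Poly_Mapping.keys m. \<phi> v ^ Poly_Mapping.lookup m v) = Poly_Mapping.single m a"
    if "m \<in> Poly_Mapping.keys f" for m a
  proof -
    have "(\<Prod>v\<in>Poly_Mapping.keys m. \<phi> v ^ Poly_Mapping.lookup m v)
        = (\<Prod>v\<in>Poly_Mapping.keys m. Poly_Mapping.single (Poly_Mapping.single v (Poly_Mapping.lookup m v)) 1)"
    proof (rule prod.cong[OF refl])
      fix v assume "v \<in> Poly_Mapping.keys m"
      then have "v \<in> dp_vars f" using that by (auto simp: dp_vars_def)
      then show "\<phi> v ^ Poly_Mapping.lookup m v
          = Poly_Mapping.single (Poly_Mapping.single v (Poly_Mapping.lookup m v)) 1"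
        by (simp add: assms pow)
    qed
    then show ?thesis
      by (simp add: prod flip: poly_mapping_eq_sum_single) (simp add: dp_const_def mult_single)
  qed
  show ?thesis
    by (subst (2) poly_mapping_eq_sum_single[of f]) (simp add: dp_eval_def mono)
qed


section \<open>Differential polynomials of degree at most one\<close>

definition lin_coeff :: "'a::zero dpoly \<Rightarrow> nat \<times> nat \<Rightarrow> 'a" where
  "lin_coeff f v = Poly_Mapping.lookup f (Poly_Mapping.single v 1)"

text \<open>
  Polynomials of degree at most one. They are determined by the constant term and the linear
  coefficients, which reduces identities about derivatives to coefficient computations.
\<close>

definition affine :: "'a::zero dpoly \<Rightarrow> bool" where
  "affine f \<longleftrightarrow> Poly_Mapping.keys f \<subseteq> insert 0 (range (\<lambda>v. Poly_Mapping.single v 1))"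

lemma single_Suc_0_eq_iff: "Poly_Mapping.single v (Suc 0) = Poly_Mapping.single w (Suc 0) \<longleftrightarrow> v = w"
  by (metis lookup_single_eq lookup_single_not_eq One_nat_def zero_neq_one)

lemma single_Suc_0_neq_0: "Poly_Mapping.single v (Suc 0) \<noteq> 0" "0 \<noteq> Poly_Mapping.single v (Suc 0)"
  by (metis lookup_single_eq lookup_zero One_nat_def zero_neq_one)+

lemma affine_eqI:
  assumes "affine f" "affine g" "Poly_Mapping.lookup f 0 = Poly_Mapping.lookup g 0"
    and "\<And>v. lin_coeff f v = lin_coeff g v"
  shows "f = g"
proof (rule poly_mapping_eqI)
  fix m
  show "Poly_Mapping.lookup f m = Poly_Mapping.lookup g m"
  proof (cases "m \<in> insert 0 (range (\<lambda>v. Poly_Mapping.single v 1))")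
    case False
    then have "m \<notin> Poly_Mapping.keys f" "m \<notin> Poly_Mapping.keys g"
      using assms(1,2) unfolding affine_def by blast+
    then show ?thesis by (simp add: in_keys_iff)
  qed (use assms(3,4) in \<open>auto simp: lin_coeff_def\<close>)
qed

lemma affine_0 [simp]: "affine 0" by (simp add: affine_def)

lemma affine_add: "affine f \<Longrightarrow> affine g \<Longrightarrow> affine (f + g)"
  using Poly_Mapping.keys_add[of f g] by (auto simp: affine_def)

lemma affine_uminus: "affine f \<Longrightarrow> affine (- f :: 'a::ab_group_add dpoly)"
  unfolding affine_def by (auto simp: in_keys_iff subset_iff)

lemma affine_diff: "affine f \<Longrightarrow> affine g \<Longrightarrow> affine (f - g :: 'a::ab_group_add dpoly)"
  using affine_add[of f "- g"] affine_uminus[of g] by simp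

lemma affine_sum: "(\<And>x. x \<in> S \<Longrightarrow> affine (f x)) \<Longrightarrow> affine (sum f S)"
  by (induction S rule: infinite_finite_induct) (auto intro: affine_add)

lemma affine_dp_const [simp]: "affine (dp_const c)"
  by (simp add: affine_def dp_const_def)

lemma affine_dp_var [simp]: "affine (dp_var v)"
  by (auto simp: affine_def dp_var_def)

lemma dp_const_mult_single: "dp_const c * Poly_Mapping.single m a = Poly_Mapping.single m (c * a :: 'a::comm_ring_1)"
  by (simp add: dp_const_def mult_single)

lemma lookup_dp_const_mult: "Poly_Mapping.lookup (dp_const c * f) m = c * Poly_Mapping.lookup (f :: 'a::comm_ring_1 dpoly) m"
proof (induction f rule: poly_mapping_single_induct)
  case (add p q) then show ?case by (simp add: distrib_left lookup_add)
next
  case (single m a) then show ?case by (simp add: dp_const_mult_single lookup_single when_def)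
qed

lemma affine_dp_const_mult: "affine f \<Longrightarrow> affine (dp_const c * f :: 'a::comm_ring_1 dpoly)"
  unfolding affine_def subset_iff in_keys_iff lookup_dp_const_mult by (metis mult_zero_right)

lemma lin_coeff_simps [simp]:
  "lin_coeff 0 v = 0"
  "lin_coeff (dp_const (c :: 'a::comm_ring_1)) v = 0"
  "lin_coeff (dp_var w :: 'a dpoly) v = (if v = w then 1 else 0)"
  "lin_coeff (f + g) v = lin_coeff f v + lin_coeff g v"
  "lin_coeff (f - g) v = lin_coeff f v - lin_coeff g v"
  "lin_coeff (- f) v = - lin_coeff f v"
  "lin_coeff (dp_const c * f) v = c * lin_coeff f v"
  "lin_coeff (sum F S) v = (\<Sum>x\<in>S. lin_coeff (F x) v)"
proof -
  show "lin_coeff (dp_const c) v = 0"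
    by (simp add: lin_coeff_def dp_const_def lookup_single when_def single_Suc_0_neq_0)
qed (auto simp: lin_coeff_def dp_var_def lookup_add lookup_minus lookup_single when_def
      single_Suc_0_eq_iff lookup_sum lookup_dp_const_mult)

lemma lookup_0_simps [simp]:
  "Poly_Mapping.lookup (dp_const (c :: 'a::comm_ring_1)) 0 = c"
  "Poly_Mapping.lookup (dp_var w :: 'a dpoly) 0 = 0"
  by (auto simp: dp_const_def dp_var_def lookup_single when_def single_Suc_0_neq_0)

lemma dp_vars_affine: "affine f \<Longrightarrow> v \<in> dp_vars f \<longleftrightarrow> lin_coeff f v \<noteq> 0"
proof
  assume f: "affine f" "v \<in> dp_vars f"
  then obtain m where m: "m \<in> Poly_Mapping.keys f" "v \<in> Poly_Mapping.keys m" by (auto simp: dp_vars_def)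
  then have "m = Poly_Mapping.single v 1" using f(1) by (auto simp: affine_def split: if_splits)
  then show "lin_coeff f v \<noteq> 0" using m by (simp add: lin_coeff_def in_keys_iff)
next
  assume "lin_coeff f v \<noteq> 0"
  then have "Poly_Mapping.single v 1 \<in> Poly_Mapping.keys f" by (simp add: lin_coeff_def in_keys_iff)
  then show "v \<in> dp_vars f" by (force simp: dp_vars_def)
qed

lemma finite_dp_vars [simp]: "finite (dp_vars f)" by (simp add: dp_vars_def)

lemma affine_expansion:
  assumes f: "affine (f :: 'a::comm_ring_1 dpoly)" and S: "finite S" "dp_vars f \<subseteq> S"
  shows "f = dp_const (Poly_Mapping.lookup f 0) + (\<Sum>v\<in>S. dp_const (lin_coeff f v) * dp_var v)" (is "_ = ?g")
proof (rule affine_eqI[OF f])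
  show "affine ?g" by (intro affine_add affine_sum affine_dp_const_mult) auto
  show "Poly_Mapping.lookup f 0 = Poly_Mapping.lookup ?g 0"
    by (simp add: lookup_add lookup_sum lookup_dp_const_mult)
  show "lin_coeff f v = lin_coeff ?g v" for v
  proof (cases "v \<in> S")
    case True
    then show ?thesis using S by (simp add: sum_mult_indicator eq_commute[of v])
  next
    case False
    then have "lin_coeff f v = 0" using dp_vars_affine[OF f, of v] S by auto
    moreover have "(\<Sum>x\<in>S. lin_coeff f x * (if v = x then 1 else 0)) = 0"
      by (rule sum.neutral) (use False in auto)
    ultimately show ?thesis by simp
  qed
qed


lemma lookup_dp_deriv_0:
  assumes "D 0 = 0"
  shows "Poly_Mapping.lookup (dp_deriv D f) 0 = D (Poly_Mapping.lookup f 0)"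
proof -
  have ne: "m + Poly_Mapping.single v (Suc 0) \<noteq> (0 :: nat \<times> nat \<Rightarrow>\<^sub>0 nat)" for m v
    by (metis add_eq_0_iff_both_eq_0 lookup_add lookup_single_eq lookup_zero nat.distinct(1))
  have "Poly_Mapping.lookup (dp_deriv D f) 0
      = (\<Sum>m\<in>Poly_Mapping.keys f. if m = 0 then D (Poly_Mapping.lookup f m) else 0)"
    by (auto simp: dp_deriv_def lookup_sum lookup_add lookup_single when_def ne intro!: sum.cong)
  also have "\<dots> = D (Poly_Mapping.lookup f 0)"
    using assms by (auto simp: in_keys_iff)
  finally show ?thesis .
qed

text \<open>
  A variable arises in the derivative of a monomial only if the monomial is itself a variable.
\<close>

lemma quotient_shift_eq_single_iff:
  assumes "v \<in> Poly_Mapping.keys (m :: nat \<times> nat \<Rightarrow>\<^sub>0 nat)"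
  shows "m - Poly_Mapping.single v 1 + Poly_Mapping.single v' 1 = Poly_Mapping.single w 1 \<longleftrightarrow>
    v' = w \<and> m = Poly_Mapping.single v 1" (is "?l = ?r")
proof
  assume l: ?l
  have pt: "Poly_Mapping.lookup m x - Poly_Mapping.lookup (Poly_Mapping.single v 1) x
      + Poly_Mapping.lookup (Poly_Mapping.single v' 1) x = Poly_Mapping.lookup (Poly_Mapping.single w 1) x" for x
    using arg_cong[OF l, of "\<lambda>p. Poly_Mapping.lookup p x"] by (simp add: lookup_add lookup_minus)
  have w: "v' = w" using pt[of v'] by (auto simp: lookup_single when_def split: if_splits)
  have "Poly_Mapping.lookup m x = Poly_Mapping.lookup (Poly_Mapping.single v 1) x" for x
    using pt[of x] assms w by (cases "x = v") (auto simp: lookup_single when_def in_keys_iff split: if_splits)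
  then show ?r using w by (auto intro: poly_mapping_eqI)
qed auto

text \<open>
  Derivatives of affine polynomials are thereby computed on coefficient vectors, over \<open>K\<close> as well as
  over \<open>K{X}\<close>.
\<close>

lemma lin_coeff_dp_deriv:
  assumes "D 0 = 0"
  shows "lin_coeff (dp_deriv D f) = shift_deriv D (lin_coeff f)"
proof
  fix w :: "nat \<times> nat"
  obtain j l where w: "w = (j, l)" by (cases w)
  let ?K = "Poly_Mapping.keys f" and ?S = "\<lambda>v. Poly_Mapping.single v (1::nat)"
  have inner: "(\<Sum>v\<in>Poly_Mapping.keys m.
        Poly_Mapping.lookup (Poly_Mapping.single (m - ?S v + ?S (fst v, Suc (snd v)))
          (of_nat (Poly_Mapping.lookup m v) * Poly_Mapping.lookup f m)) (?S w))
      = (case l of 0 \<Rightarrow> 0 | Suc l' \<Rightarrow> if m = ?S (j, l') then Poly_Mapping.lookup f m else 0)" (is "?L = ?R") for m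
  proof -
    have "?L = (\<Sum>v\<in>Poly_Mapping.keys m. if Suc (snd v) = l \<and> fst v = j \<and> m = ?S v
        then Poly_Mapping.lookup f m else 0)"
    proof (rule sum.cong[OF refl])
      fix v assume "v \<in> Poly_Mapping.keys m"
      note q = quotient_shift_eq_single_iff[OF this, of "(fst v, Suc (snd v))" w]
      show "Poly_Mapping.lookup (Poly_Mapping.single (m - ?S v + ?S (fst v, Suc (snd v)))
          (of_nat (Poly_Mapping.lookup m v) * Poly_Mapping.lookup f m)) (?S w)
        = (if Suc (snd v) = l \<and> fst v = j \<and> m = ?S v then Poly_Mapping.lookup f m else 0)"
        unfolding lookup_single when_def q by (auto simp: w)
    qed
    also have "\<dots> = ?R"
    proof (cases "\<exists>l'. l = Suc l' \<and> m = ?S (j, l')")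
      case True
      then obtain l' where l': "l = Suc l'" "m = ?S (j, l')" by blast
      then show ?thesis by simp
    next
      case False
      then show ?thesis by (auto intro!: sum.neutral split: nat.splits)
    qed
    finally show ?thesis .
  qed
  have "lin_coeff (dp_deriv D f) w = (\<Sum>m\<in>?K. (if m = ?S w then D (Poly_Mapping.lookup f m) else 0)
      + (case l of 0 \<Rightarrow> 0 | Suc l' \<Rightarrow> if m = ?S (j, l') then Poly_Mapping.lookup f m else 0))"
    unfolding lin_coeff_def dp_deriv_def lookup_sum lookup_add inner
    by (simp add: lookup_single when_def)
  also have "\<dots> = D (lin_coeff f w) + (case l of 0 \<Rightarrow> 0 | Suc l' \<Rightarrow> lin_coeff f (j, l'))"
    using assms by (cases l) (auto simp: sum.distrib in_keys_iff lin_coeff_def)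
  finally show "lin_coeff (dp_deriv D f) w = shift_deriv D (lin_coeff f) w"
    by (simp add: w shift_deriv_def)
qed

lemma affine_dp_deriv:
  assumes "affine f"
  shows "affine (dp_deriv D f)"
  unfolding dp_deriv_def
proof (intro affine_sum affine_add)
  fix m assume m: "m \<in> Poly_Mapping.keys f"
  show "affine (Poly_Mapping.single m (D (Poly_Mapping.lookup f m)))"
    using m assms by (auto simp: affine_def)
  fix v assume v: "v \<in> Poly_Mapping.keys m"
  then have "m = Poly_Mapping.single v 1"
    using m assms by (auto simp: affine_def split: if_splits)
  then show "affine (Poly_Mapping.single (m - Poly_Mapping.single v 1 + Poly_Mapping.single (fst v, Suc (snd v)) 1)
      (of_nat (Poly_Mapping.lookup m v) * Poly_Mapping.lookup f m))"
    by (auto simp: affine_def)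
qed

lemma dp_deriv_pow_affine:
  assumes "affine f" "D 0 = 0"
  shows "affine ((dp_deriv D ^^ k) f)"
    and "Poly_Mapping.lookup ((dp_deriv D ^^ k) f) 0 = (D ^^ k) (Poly_Mapping.lookup f 0)"
    and "lin_coeff ((dp_deriv D ^^ k) f) = (shift_deriv D ^^ k) (lin_coeff f)"
  by (induction k) (simp_all add: assms affine_dp_deriv lookup_dp_deriv_0 lin_coeff_dp_deriv)

lemma dp_deriv_pow_dp_var:
  assumes "derivation d"
  shows "(dp_deriv d ^^ k) (dp_var (j, l)) = dp_var (j, l + k)"
proof (induction k)
  case (Suc k)
  have "dp_deriv d (dp_var (j, l + k)) = dp_var (j, Suc (l + k))"
    by (rule affine_eqI)
      (auto simp: affine_dp_deriv lookup_dp_deriv_0 lin_coeff_dp_deriv derivation_0[OF assms]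
        derivation_1[OF assms] shift_deriv_def split: nat.splits if_splits)
  then show ?case using Suc by simp
qed simp



section \<open>Irreducibility and injective substitutions\<close>

lemma dp_eval_cong:
  assumes "\<And>v. v \<in> dp_vars f \<Longrightarrow> \<phi> v = \<psi> v"
  shows "dp_eval hm \<phi> f = dp_eval hm \<psi> f"
proof -
  have "\<phi> v = \<psi> v" if "m \<in> Poly_Mapping.keys f" "v \<in> Poly_Mapping.keys m" for m v
    by (rule assms) (use that in \<open>auto simp: dp_vars_def\<close>)
  then show ?thesis by (simp add: dp_eval_def)
qed

lemma comm_ring_hom_coeff_lift: "comm_ring_hom (\<lambda>a :: 'a::comm_ring_1. [:a:])"
  by unfold_locales (auto simp: one_pCons)

lemma comm_ring_hom_comp:
  assumes "comm_ring_hom f" "comm_ring_hom g"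
  shows "comm_ring_hom (f \<circ> g)"
proof -
  interpret f: comm_ring_hom f by fact
  interpret g: comm_ring_hom g by fact
  show ?thesis by unfold_locales (simp_all add: hom_distribs)
qed

lemma comm_ring_hom_poly: "comm_ring_hom (\<lambda>p. poly p (x :: 'a::comm_ring_1))"
  by unfold_locales auto

text \<open>
  View \<open>f\<close> as a polynomial of degree one in \<open>v\<close> over the remaining variables. One factor of a
  factorization is then free of \<open>v\<close>, and it divides the coefficient of \<open>v\<close> in \<open>f\<close>, which is a nonzero
  constant.
\<close>

lemma irreducible_affine:
  fixes f :: "'k::field dpoly"
  assumes f: "affine f" and v: "lin_coeff f v \<noteq> 0"
  shows "irreducible f"
proof -
  define \<phi> where "\<phi> w = (if w = v then [:0, 1:] else [:dp_var w :: 'k dpoly:])" for w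
  define \<theta> where "\<theta> = dp_eval ((\<lambda>a. [:a:]) \<circ> dp_const) \<phi>"
  interpret E: evaluation "(\<lambda>a. [:a:]) \<circ> (dp_const :: 'k \<Rightarrow> 'k dpoly)" \<phi>
    unfolding evaluation_def
    by (rule comm_ring_hom_comp[OF comm_ring_hom_coeff_lift comm_ring_hom_dp_const])
  interpret \<theta>: comm_ring_hom \<theta> unfolding \<theta>_def by (rule E.comm_ring_hom_ev)
  define c where "c = lin_coeff f v"
  define g where "g = f - dp_const c * dp_var v"
  have "affine g" unfolding g_def using f by (intro affine_diff affine_dp_const_mult) auto
  then have "v \<notin> dp_vars g" by (simp add: dp_vars_affine g_def c_def)
  then have "\<theta> g = dp_eval ((\<lambda>a. [:a:]) \<circ> dp_const) ((\<lambda>a. [:a:]) \<circ> dp_var) g"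
    unfolding \<theta>_def by (intro dp_eval_cong) (auto simp: \<phi>_def)
  also have "\<dots> = [:g:]"
    by (simp add: dp_eval_eq_self flip: hom_dp_eval[OF comm_ring_hom_coeff_lift])
  finally have \<theta>g: "\<theta> g = [:g:]" .
  have "f = dp_const c * dp_var v + g" by (simp add: g_def)
  then have "\<theta> f = \<theta> (dp_const c) * \<theta> (dp_var v) + \<theta> g" by (metis \<theta>.hom_add \<theta>.hom_mult)
  also have "\<dots> = [:g, dp_const c:]" by (simp add: \<theta>g) (simp add: \<theta>_def \<phi>_def)
  finally have \<theta>f: "\<theta> f = [:g, dp_const c:]" .
  have c_unit: "dp_const c dvd (1 :: 'k dpoly)"
  proof
    show "1 = dp_const c * dp_const (inverse c)" using v
      by (simp add: c_def dp_const_def mult_single)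
  qed
  have c_ne: "dp_const c \<noteq> (0 :: 'k dpoly)" using c_unit by auto
  \<comment> \<open>Evaluating the new indeterminate at v recovers the original polynomial.\<close>
  have \<theta>_back: "poly (\<theta> p) (dp_var v) = p" for p
  proof -
    have "poly (\<theta> p) (dp_var v) = dp_eval ((\<lambda>q. poly q (dp_var v)) \<circ> ((\<lambda>a. [:a:]) \<circ> dp_const))
        ((\<lambda>q. poly q (dp_var v)) \<circ> \<phi>) p"
      unfolding \<theta>_def by (rule hom_dp_eval[OF comm_ring_hom_poly])
    also have "\<dots> = dp_eval dp_const dp_var p"
      by (intro arg_cong2[of _ _ _ _ "\<lambda>a b. dp_eval a b p"]) (auto simp: \<phi>_def fun_eq_iff)
    also have "\<dots> = p" by (rule dp_eval_eq_self) simp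
    finally show ?thesis .
  qed
  have unit: "b dvd 1" if eq: "\<theta> a * \<theta> b = \<theta> f" and deg: "degree (\<theta> b) = 0" for a b
  proof -
    obtain b0 where b0: "\<theta> b = [:b0:]" using deg by (rule degree_eq_zeroE)
    have "b = b0" using \<theta>_back[of b] b0 by simp
    have "dp_const c = coeff (\<theta> a * \<theta> b) 1" by (simp add: eq \<theta>f)
    also have "\<dots> = coeff (\<theta> a) 1 * b0" unfolding b0 by (simp add: mult.commute)
    finally show ?thesis using c_unit \<open>b = b0\<close> by (metis dvd_triv_right dvd_trans)
  qed
  show ?thesis
  proof (rule irreducibleI)
    show "f \<noteq> 0" using v by auto
    show "\<not> f dvd 1"
    proof
      assume "f dvd 1"
      then obtain h where "1 = f * h" ..
      then have "1 = \<theta> f * \<theta> h" by (metis \<theta>.hom_mult \<theta>.hom_one)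
      then have "\<theta> f dvd 1" by (rule dvdI)
      then show False using c_ne by (simp add: \<theta>f is_unit_poly_iff)
    qed
    fix a b assume "f = a * b"
    then have eq: "\<theta> a * \<theta> b = \<theta> f" by (simp add: \<theta>.hom_mult)
    moreover have "\<theta> a \<noteq> 0" "\<theta> b \<noteq> 0" using eq c_ne by (auto simp: \<theta>f)
    \<comment> \<open>The ring of differential polynomials is a domain because monomials are ordered; this is where the lexicographic order on pairs enters.\<close>
    ultimately have "degree (\<theta> a) + degree (\<theta> b) = 1"
      using degree_mult_eq[of "\<theta> a" "\<theta> b"] c_ne by (simp add: \<theta>f)
    then have "degree (\<theta> a) = 0 \<or> degree (\<theta> b) = 0" by auto
    then show "a dvd 1 \<or> b dvd 1" using unit[of a b] unit[of b a] eq by (auto simp: mult.commute)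
  qed
qed

lemma vector_space_dpoly: "vector_space (\<lambda>(c :: 'k::field) (p :: 'k dpoly). dp_const c * p)"
proof -
  interpret comm_ring_hom "dp_const :: 'k \<Rightarrow> 'k dpoly" by (rule comm_ring_hom_dp_const)
  show ?thesis by unfold_locales (simp_all add: algebra_simps hom_distribs)
qed

text \<open>
  The linear parts of the \<open>G v\<close> are linearly independent, so some linear map \<open>g\<close> sends the linear part
  of each \<open>G v\<close> to \<open>v\<close> minus the constant term of \<open>G v\<close>. Evaluation of the variables under \<open>g\<close> is then a
  left inverse of the substitution \<open>v \<mapsto> G v\<close>.
\<close>

lemma dp_eval_affine_injective:
  fixes G :: "nat \<times> nat \<Rightarrow> 'k::field dpoly"
  assumes G: "\<And>v. v \<in> T \<Longrightarrow> affine (G v)"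
    and indep: "\<And>S y. \<lbrakk>finite S; S \<subseteq> T; \<And>w. (\<Sum>v\<in>S. y v * lin_coeff (G v) w) = 0\<rbrakk> \<Longrightarrow> \<forall>v\<in>S. y v = 0"
    and f: "dp_vars f \<subseteq> T" "dp_eval dp_const G f = 0"
  shows "f = 0"
proof -
  let ?scale = "\<lambda>(c :: 'k) (p :: 'k dpoly). dp_const c * p"
  interpret vector_space ?scale by (rule vector_space_dpoly)
  interpret pair: vector_space_pair ?scale ?scale ..
  define lin where "lin v = G v - dp_const (Poly_Mapping.lookup (G v) 0)" for v
  have inj: "inj_on lin T"
  proof (rule inj_onI, rule ccontr)
    fix v v' assume v: "v \<in> T" "v' \<in> T" "lin v = lin v'" "v \<noteq> v'"
    have "lin_coeff (G v) w = lin_coeff (G v') w" for w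
      using arg_cong[OF v(3), of "\<lambda>p. lin_coeff p w"] by (simp add: lin_def)
    then have "\<forall>x\<in>{v, v'}. (if x = v then 1 else - 1 :: 'k) = 0"
      by (intro indep) (use v in auto)
    then show False by simp
  qed
  have "independent (lin ` T)"
    unfolding independent_explicit_module
  proof (intro allI impI)
    fix B u b assume B: "finite B" "B \<subseteq> lin ` T" "(\<Sum>b\<in>B. dp_const (u b) * b) = 0" "b \<in> B"
    obtain S where S: "S \<subseteq> T" "finite S" "B = lin ` S" using B(1,2) by (meson finite_subset_image)
    have injS: "inj_on lin S" using inj S(1) by (rule inj_on_subset)
    have "(\<Sum>v\<in>S. u (lin v) * lin_coeff (G v) w) = 0" for w
    proof -
      have "lin_coeff (\<Sum>b\<in>B. dp_const (u b) * b) w = 0" by (simp only: B(3) lin_coeff_simps)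
      then show ?thesis using injS by (simp add: S(3) sum.reindex) (simp add: lin_def)
    qed
    then have "\<forall>v\<in>S. u (lin v) = 0" by (rule indep[OF S(2,1)])
    then show "u b = 0" using B(4) S(3) by auto
  qed
  then obtain g where g: "Vector_Spaces.linear ?scale ?scale g"
    and g_eq: "\<forall>b\<in>lin ` T. g b = (dp_var (inv_into T lin b)
      - dp_const (Poly_Mapping.lookup (G (inv_into T lin b)) 0))"
    using pair.linear_independent_extend[of "lin ` T" "\<lambda>b. dp_var (inv_into T lin b)
      - dp_const (Poly_Mapping.lookup (G (inv_into T lin b)) 0)"] by blast
  interpret g: Vector_Spaces.linear ?scale ?scale g by (rule g)
  have g_lin: "g (lin v) = dp_var v - dp_const (Poly_Mapping.lookup (G v) 0)" if "v \<in> T" for v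
    using g_eq that inj by simp
  interpret E: evaluation "dp_const :: 'k \<Rightarrow> 'k dpoly" "\<lambda>w. g (dp_var w)"
    using comm_ring_hom_dp_const by (simp add: evaluation_def)
  interpret \<sigma>: comm_ring_hom E.ev by (rule E.comm_ring_hom_ev)
  have \<sigma>G: "E.ev (G v) = dp_var v" if v: "v \<in> T" for v
  proof -
    let ?c = "Poly_Mapping.lookup (G v) 0" and ?S = "dp_vars (G v)"
    have exp: "G v = dp_const ?c + (\<Sum>w\<in>?S. dp_const (lin_coeff (G v) w) * dp_var w)"
      by (rule affine_expansion[OF G[OF v]]) auto
    then have lin: "lin v = (\<Sum>w\<in>?S. dp_const (lin_coeff (G v) w) * dp_var w)"
      by (simp add: lin_def algebra_simps)
    have "E.ev (G v) = dp_const ?c + (\<Sum>w\<in>?S. dp_const (lin_coeff (G v) w) * g (dp_var w))"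
      by (subst exp) (simp add: hom_distribs)
    also have "(\<Sum>w\<in>?S. dp_const (lin_coeff (G v) w) * g (dp_var w)) = g (lin v)"
      by (simp add: lin g.sum g.scale)
    finally show ?thesis by (simp add: g_lin[OF v])
  qed
  have "0 = E.ev (dp_eval dp_const G f)" by (simp add: f(2))
  also have "\<dots> = dp_eval (E.ev \<circ> dp_const) (E.ev \<circ> G) f" by (rule hom_dp_eval) (rule E.comm_ring_hom_ev)
  also have "E.ev \<circ> dp_const = dp_const" by (simp add: fun_eq_iff)
  also have "dp_eval dp_const (E.ev \<circ> G) f = f"
    by (rule dp_eval_eq_self) (use f(1) \<sigma>G in auto)
  finally show ?thesis by simp
qed

section \<open>Rankings and characteristic sets with one element\<close>

lemma ranking_irrefl: "\<not> lt u u"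
  and ranking_total: "u \<noteq> v \<Longrightarrow> lt u v \<or> lt v u"
  and ranking_deriv: "lt u (fst u, Suc (snd u))"
  and ranking_trans: "\<lbrakk>fst w \<in> {1..n}; lt u v; lt v w\<rbrakk> \<Longrightarrow> lt u w"
  if r: "ranking n lt" and range: "fst u \<in> {1..n}" "fst v \<in> {1..n}"
proof -
  let ?D = "{1..n} \<times> (UNIV :: nat set)"
  have u: "u \<in> ?D" and v: "v \<in> ?D" and w: "fst w \<in> {1..n} \<Longrightarrow> w \<in> ?D"
    using range by (simp_all add: mem_Times_iff)
  note conds = r[unfolded ranking_def Let_def]
  show "\<not> lt u u" using conds[THEN conjunct1] u by blast
  show "u \<noteq> v \<Longrightarrow> lt u v \<or> lt v u"
    using conds[THEN conjunct2, THEN conjunct2, THEN conjunct1] u v by blast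
  show "lt u (fst u, Suc (snd u))"
    using conds[THEN conjunct2, THEN conjunct2, THEN conjunct2, THEN conjunct1] u by blast
  show "\<lbrakk>fst w \<in> {1..n}; lt u v; lt v w\<rbrakk> \<Longrightarrow> lt u w"
    using conds[THEN conjunct2, THEN conjunct1] u v w by blast
qed

lemma ranking_higher_derivative:
  assumes "ranking n lt" "i \<in> {1..n}" "k < k'"
  shows "lt (i, k) (i, k')"
  using assms(3)
proof (induction k')
  case (Suc k')
  have step: "lt (i, k') (i, Suc k')" using ranking_deriv[OF assms(1), of "(i, k')" "(i, k')"] assms(2) by simp
  show ?case
  proof (cases "k = k'")
    case False
    then have "lt (i, k) (i, k')" using Suc by simp
    then show ?thesis
      using ranking_trans[OF assms(1), of "(i, k)" "(i, k')" "(i, Suc k')"] assms(2) step by simp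
  qed (use step in simp)
qed simp

lemma dpolys_index: "f \<in> dpolys S \<Longrightarrow> w \<in> dp_vars f \<Longrightarrow> fst w \<in> S"
  unfolding dpolys_def by (auto dest: subsetD)

lemma leader_max:
  assumes r: "ranking n lt" and f: "f \<in> dpolys {1..n}" "dp_vars f \<noteq> {}"
  shows "leader lt f \<in> dp_vars f" "\<And>w. w \<in> dp_vars f \<Longrightarrow> w \<noteq> leader lt f \<Longrightarrow> lt w (leader lt f)"
proof -
  have "\<exists>v\<in>V. \<forall>w\<in>V. w \<noteq> v \<longrightarrow> lt w v" if "finite V" "V \<noteq> {}" "fst ` V \<subseteq> {1..n}" for V
    using that
  proof (induction V rule: finite_ne_induct)
    case (insert x V)
    then obtain v where v: "v \<in> V" "\<forall>w\<in>V. w \<noteq> v \<longrightarrow> lt w v" by auto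
    have in_range: "fst x \<in> {1..n}" "\<And>w. w \<in> V \<Longrightarrow> fst w \<in> {1..n}" using insert.prems by auto
    consider "lt x v" | "lt v x"
      using ranking_total[OF r in_range(1) in_range(2)[OF v(1)]] v(1) insert.hyps by auto
    then show ?case
    proof cases
      case 1 then show ?thesis using v by (intro bexI[of _ v]) auto
    next
      case 2
      have "lt w x" if "w \<in> V" for w
        using ranking_trans[OF r in_range(2)[OF that] in_range(2)[OF v(1)] in_range(1)] v(2) 2 that
        by (cases "w = v") auto
      then show ?thesis by (intro bexI[of _ x]) auto
    qed
  qed auto
  moreover have range: "fst ` dp_vars f \<subseteq> {1..n}" using f(1) by (auto simp: dpolys_def)
  ultimately obtain v where v: "v \<in> dp_vars f" "\<forall>w\<in>dp_vars f. w \<noteq> v \<longrightarrow> lt w v"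
    using f(2) finite_dp_vars by metis
  have "leader lt f = v"
    unfolding leader_def
  proof (rule the_equality)
    fix v' assume v': "v' \<in> dp_vars f \<and> (\<forall>w\<in>dp_vars f. w \<noteq> v' \<longrightarrow> lt w v')"
    show "v' = v"
    proof (rule ccontr)
      assume "v' \<noteq> v"
      then have "lt v v'" "lt v' v" using v v' by auto
      moreover have "fst v \<in> {1..n}" "fst v' \<in> {1..n}" using range v(1) v' by auto
      ultimately show False using ranking_trans[OF r, of v v' v] ranking_irrefl[OF r, of v v] by blast
    qed
  qed (use v in auto)
  then show "leader lt f \<in> dp_vars f" "\<And>w. w \<in> dp_vars f \<Longrightarrow> w \<noteq> leader lt f \<Longrightarrow> lt w (leader lt f)"
    using v by auto
qed

lemma dp_deg_pos: "v \<in> dp_vars f \<longleftrightarrow> 0 < dp_deg f v"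
proof -
  have "0 < dp_deg f v \<longleftrightarrow> (\<exists>m\<in>Poly_Mapping.keys f. 0 < Poly_Mapping.lookup m v)"
    unfolding dp_deg_def by (subst Max_gr_iff) auto
  then show ?thesis by (auto simp: dp_vars_def in_keys_iff)
qed

lemma dp_deg_affine_le: "affine f \<Longrightarrow> dp_deg f v \<le> 1"
  unfolding dp_deg_def by (subst Max_le_iff) (auto simp: affine_def lookup_single when_def split: if_splits)

text \<open>
  An autoreduced set below \<open>[A]\<close> either starts with an element of lower rank than \<open>A\<close>, or continues an
  element with the rank of \<open>A\<close>. As \<open>A\<close> has degree one in its leader \<open>(i, k)\<close>, both the first element in
  the former case and the second one in the latter contain no \<open>(i, k')\<close> with \<open>k' \<ge> k\<close>.
\<close>

lemma characteristic_set_singleton: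
  assumes r: "ranking n lt" and I: "I \<subseteq> dpolys {1..n}"
    and A: "A \<in> I" "affine A" "dp_vars A \<noteq> {}"
    and avoid: "\<And>i k f. \<lbrakk>(i, k) \<in> dp_vars A; \<forall>k'>k. (i, k') \<notin> dp_vars A; f \<in> I;
      \<forall>k'\<ge>k. (i, k') \<notin> dp_vars f\<rbrakk> \<Longrightarrow> f = 0"
  shows "characteristic_set lt I {A}"
proof -
  obtain i k where lead: "leader lt A = (i, k)" by fastforce
  note lead_A = leader_max[OF r subsetD[OF I A(1)] A(3), unfolded lead]
  have i: "i \<in> {1..n}" using dpolys_index[OF subsetD[OF I A(1)] lead_A(1)] by simp
  have top: "\<forall>k'>k. (i, k') \<notin> dp_vars A"
  proof (intro allI impI notI)
    fix k' assume k': "k < k'" "(i, k') \<in> dp_vars A"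
    then have "lt (i, k') (i, k)" using lead_A(2)[of "(i, k')"] by auto
    moreover have "lt (i, k) (i, k')" using ranking_higher_derivative[OF r i k'(1)] .
    ultimately show False
      using ranking_trans[OF r, of "(i, k)" "(i, k')" "(i, k)"] ranking_irrefl[OF r, of "(i, k)" "(i, k)"] i
      by auto
  qed
  have deg_A: "dp_deg A (i, k) = 1"
    using dp_deg_affine_le[OF A(2), of "(i, k)"] lead_A(1) dp_deg_pos[of "(i, k)" A] by simp
  have no_vars: "dp_vars (0 :: 'a dpoly) = {}" by (simp add: dp_vars_def)
  have not_less: "\<not> rank_less lt B A" if B: "B \<in> I" "dp_vars B \<noteq> {}" for B
  proof
    assume less: "rank_less lt B A"
    note lead_B = leader_max[OF r subsetD[OF I B(1)] B(2)]
    have deg_B: "0 < dp_deg B (leader lt B)" using lead_B(1) by (simp add: dp_deg_pos)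
    have lt_B: "lt (leader lt B) (i, k)" using less deg_B by (auto simp: rank_less_def lead deg_A)
    have B_range: "\<And>w. w \<in> dp_vars B \<Longrightarrow> fst w \<in> {1..n}"
      using dpolys_index[OF subsetD[OF I B(1)]] .
    have below: "lt w (i, k)" if "w \<in> dp_vars B" for w
      using ranking_trans[OF r B_range[OF that] B_range[OF lead_B(1)], of "(i, k)"] lead_B(2)[OF that] lt_B i
      by (cases "w = leader lt B") auto
    have "(i, k') \<notin> dp_vars B" if "k' \<ge> k" for k'
    proof
      assume "(i, k') \<in> dp_vars B"
      then have "lt (i, k') (i, k)" by (rule below)
      moreover have "k' = k \<or> lt (i, k) (i, k')"
        using ranking_higher_derivative[OF r i, of k k'] that by (cases "k = k'") auto
      ultimately show False
        using ranking_trans[OF r, of "(i, k)" "(i, k')" "(i, k)"] ranking_irrefl[OF r, of "(i, k)" "(i, k)"] i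
        by auto
    qed
    then have "B = 0" using avoid[OF lead_A(1) top B(1)] by blast
    then show False using B(2) no_vars by simp
  qed
  show ?thesis
    unfolding characteristic_set_def
  proof (rule exI[of _ "[A]"], intro conjI allI impI)
    show "autoreduced_in lt I [A]" using A by (simp add: autoreduced_in_def)
    fix Bs assume Bs: "autoreduced_in lt I Bs"
    show "\<not> chain_lower lt Bs [A]"
    proof
      assume "chain_lower lt Bs [A]"
      then consider "Bs \<noteq> []" "rank_less lt (Bs ! 0) A" | "1 < length Bs" "rank_eq lt (Bs ! 0) A"
        by (auto simp: chain_lower_def)
      then show False
      proof cases
        case 1
        then have "Bs ! 0 \<in> set Bs" by simp
        then show False using not_less[of "Bs ! 0"] 1 Bs unfolding autoreduced_in_def by blast
      next
        case 2
        let ?B = "Bs ! 0" and ?B' = "Bs ! 1"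
        have mem: "?B \<in> set Bs" "?B' \<in> set Bs" using 2 by (auto intro: nth_mem)
        have "rank_less lt ?B ?B'"
          using Bs 2 by (auto simp: autoreduced_in_def intro: sorted_wrt_nth_less)
        have lead_B: "leader lt ?B = (i, k)" "dp_deg ?B (i, k) = 1"
          using 2 deg_A lead by (auto simp: rank_eq_def)
        have "?B' \<noteq> ?B"
        proof
          assume "?B' = ?B"
          then have "lt (i, k) (i, k)" using \<open>rank_less lt ?B ?B'\<close> lead_B by (simp add: rank_less_def)
          then show False using ranking_irrefl[OF r, of "(i, k)" "(i, k)"] i by simp
        qed
        then have "reduced_wrt lt ?B' ?B" using Bs mem by (simp add: autoreduced_in_def)
        then have "\<forall>k'>k. (i, k') \<notin> dp_vars ?B'" "(i, k) \<notin> dp_vars ?B'"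
          using lead_B by (auto simp: reduced_wrt_def dp_deg_pos)
        then have "\<forall>k'\<ge>k. (i, k') \<notin> dp_vars ?B'" by (auto simp: le_less)
        moreover have "?B' \<in> I" using Bs mem unfolding autoreduced_in_def by blast
        ultimately have "?B' = 0" using avoid[OF lead_A(1) top] by blast
        then show False using Bs mem(2) no_vars by (auto simp: autoreduced_in_def)
      qed
    qed
  qed simp
qed

text \<open>
  A ranking has to be exhibited, because the dimension also asks for the existence of some
  characteristic set.
\<close>

lemma orderly_ranking: "ranking n (\<lambda>v w. snd v < snd w \<or> snd v = snd w \<and> fst v < fst w)"
  by (auto simp: ranking_def Let_def prod_eq_iff)

text \<open>
  Two characteristic sets for the same ranking are both minimal, hence have equal length: neither
  may have a smaller first element or be a proper extension of the other.
\<close>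

lemma has_diff_dim_singleton:
  assumes n: "n \<ge> 1" and I: "I \<subseteq> dpolys {1..n}"
    and A: "\<And>lt. ranking n lt \<Longrightarrow> characteristic_set lt I {A}"
  shows "has_diff_dim n I (n - 1)"
proof -
  have "card C = 1" if r: "ranking n lt" and C: "characteristic_set lt I C" for lt C
  proof -
    obtain Bs where Bs: "set Bs = C" "autoreduced_in lt I Bs"
      "\<And>Cs. autoreduced_in lt I Cs \<Longrightarrow> \<not> chain_lower lt Cs Bs"
      using C by (auto simp: characteristic_set_def)
    obtain As where As: "set As = {A}" "autoreduced_in lt I As"
      "\<And>Cs. autoreduced_in lt I Cs \<Longrightarrow> \<not> chain_lower lt Cs As"
      using A[OF r] unfolding characteristic_set_def by blast
    have range: "\<And>f w. f \<in> I \<Longrightarrow> w \<in> dp_vars f \<Longrightarrow> fst w \<in> {1..n}"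
      using dpolys_index subsetD[OF I] by blast
    have lead: "leader lt f \<in> dp_vars f" "f \<in> I" if "f \<in> set Cs" "autoreduced_in lt I Cs" for f Cs
      using leader_max(1)[OF r, of f] that I by (auto simp: autoreduced_in_def)
    have As_single: "As = [A]"
    proof (cases As)
      case (Cons B Cs)
      have "Cs = []"
      proof (rule ccontr)
        assume "Cs \<noteq> []"
        then have "rank_less lt A A" using As(1,2) Cons
          by (cases Cs) (auto simp: autoreduced_in_def)
        then have "lt (leader lt A) (leader lt A)" by (simp add: rank_less_def)
        moreover have "fst (leader lt A) \<in> {1..n}" using lead[of A As] As(1,2) range by blast
        ultimately show False using ranking_irrefl[OF r] by blast
      qed
      then show ?thesis using As(1) Cons by simp
    qed (use As in simp)
    have not_AB: "\<not> chain_lower lt [A] Bs" and not_BA: "\<not> chain_lower lt Bs [A]"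
      using As Bs As_single by auto
    have "Bs \<noteq> []" using not_AB by (auto simp: chain_lower_def)
    then obtain B Cs where Cons: "Bs = B # Cs" by (meson neq_Nil_conv)
    have not_less: "\<not> rank_less lt A B" "\<not> rank_less lt B A"
      using not_AB not_BA by (force simp: chain_lower_def Cons)+
    have "fst (leader lt A) \<in> {1..n}" "fst (leader lt B) \<in> {1..n}"
      using range[OF lead(2,1)[OF _ As(2)]] range[OF lead(2,1)[OF _ Bs(2)]] As(1) Cons by simp_all
    then have "rank_eq lt B A"
      using not_less ranking_total[OF r, of "leader lt A" "leader lt B"]
      by (cases "leader lt A = leader lt B") (auto simp: rank_less_def rank_eq_def)
    then have "Cs = []" using not_BA by (auto simp: chain_lower_def Cons)
    then show ?thesis using Bs(1) Cons by auto
  qed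
  then show ?thesis
    using A[OF orderly_ranking] orderly_ranking[of n] n unfolding has_diff_dim_def by auto
qed

section \<open>The resultants of a linear system\<close>

lemma distinct_concat_map_tagged:
  assumes "distinct is" "\<And>i. distinct (f i)" "\<And>i x. x \<in> set (f i) \<Longrightarrow> tag x = i"
  shows "distinct (concat (map f is))"
  using assms(1)
proof (induction "is")
  case (Cons i "is")
  have "set (f i) \<inter> set (f i') = {}" if "i' \<in> set is" for i'
    using assms(3)[of _ i] assms(3)[of _ i'] that Cons.prems by auto
  then show ?case using Cons assms(2) by auto
qed simp

text \<open>
  The labels \<open>(i, k)\<close>, \<open>k < M i\<close>, in the order in which the rows of the resultant matrices are listed.
\<close>

definition row_index :: "nat \<Rightarrow> (nat \<Rightarrow> nat) \<Rightarrow> (nat \<times> nat) list" where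
  "row_index n M = concat (map (\<lambda>i. map (Pair i) (rev [0..<M i])) [1..<n + 1])"

lemma set_row_index: "set (row_index n M) = (SIGMA i:{1..n}. {..<M i})"
  by (auto simp: row_index_def)

lemma distinct_row_index: "distinct (row_index n M)"
  unfolding row_index_def
  by (rule distinct_concat_map_tagged[where tag = fst]) (auto simp: distinct_map inj_on_def)

lemma length_row_index: "length (row_index n M) = (\<Sum>i = 1..n. M i)"
  using distinct_card[OF distinct_row_index, of n M] by (simp add: set_row_index)

lemma CRes_rows_eq:
  "CRes_rows d n F = map (\<lambda>(i, k). (dp_deriv (dp_deriv d) ^^ k) (F i))
     (row_index n (\<lambda>i. res_N n F - total_ord (F i) - gam_sum n F + 1))"
  by (simp add: CRes_rows_def row_index_def map_concat comp_def)

lemma CResh_rows_eq: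
  "CResh_rows d n F H = map (\<lambda>(i, k). (dp_deriv d ^^ k) (H i))
     (row_index n (\<lambda>i. res_N n F - total_ord (F i) - gam_sum n F))"
  by (simp add: CResh_rows_def row_index_def map_concat comp_def)

lemma distinct_res_cols: "distinct (res_cols n F e)"
  unfolding res_cols_def
  by (rule distinct_concat_map_tagged[where tag = snd]) (auto simp: distinct_map inj_on_def)

lemma set_res_cols:
  "set (res_cols n F e) = {(j, k). j \<in> {1..n - 1} \<and> k + gam n F j + gam_sum n F + e \<le> res_N n F}"
  by (auto simp: res_cols_def image_iff simp del: upt_Suc)

lemma affine_lin_H: "affine (lin_H d n L i)"
  and lookup_lin_H_0: "Poly_Mapping.lookup (lin_H d n L i) 0 = 0"
  and lin_coeff_lin_H: "lin_coeff (lin_H d n L i) (j, l) = (if j \<in> {1..n - 1} then poly.coeff (L i j) l else 0)"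
  if d: "derivation d"
proof -
  have eq: "lin_H d n L i = (\<Sum>j = 1..n - 1. \<Sum>k\<le>degree (L i j). dp_const (poly.coeff (L i j) k) * dp_var (j, k))"
    by (simp add: lin_H_def dop_apply_def dp_deriv_pow_dp_var[OF d])
  show "affine (lin_H d n L i)" unfolding eq by (intro affine_sum affine_dp_const_mult) simp
  show "Poly_Mapping.lookup (lin_H d n L i) 0 = 0"
    by (simp add: eq lookup_sum lookup_dp_const_mult)
  have inner: "(\<Sum>k\<le>degree (L i j'). poly.coeff (L i j') k * (if (j, l) = (j', k) then 1 else 0))
      = (if j = j' then poly.coeff (L i j') l else 0)" for j'
  proof (cases "j = j' \<and> l \<le> degree (L i j')")
    case True
    have "(\<Sum>k\<le>degree (L i j'). poly.coeff (L i j') k * (if (j, l) = (j', k) then 1 else 0))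
        = (\<Sum>k\<le>degree (L i j'). poly.coeff (L i j') k * (if k = l then 1 else 0))"
      by (intro sum.cong) (use True in auto)
    then show ?thesis using True by (simp add: sum_mult_indicator)
  next
    case False
    then show ?thesis by (auto intro!: sum.neutral simp: coeff_eq_0)
  qed
  have "lin_coeff (lin_H d n L i) (j, l) = (\<Sum>j' = 1..n - 1. if j = j' then poly.coeff (L i j') l else 0)"
    unfolding eq lin_coeff_simps inner ..
  then show "lin_coeff (lin_H d n L i) (j, l) = (if j \<in> {1..n - 1} then poly.coeff (L i j) l else 0)"
    by simp
qed

lemma dp_deriv_0 [simp]: "dp_deriv D 0 = 0" by (simp add: dp_deriv_def)

lemma dp_const_0 [simp]: "dp_const 0 = 0" by (simp add: dp_const_def)

lemma lookup_lin_F: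
  assumes "derivation d"
  shows "Poly_Mapping.lookup (lin_F d n a L i) 0 = dp_var (i, 0) - dp_const (a i)"
    and "lin_coeff (lin_F d n a L i) v = dp_const (lin_coeff (lin_H d n L i) v)"
    and "affine (lin_F d n a L i)"
proof -
  have map: "Poly_Mapping.lookup (Poly_Mapping.map dp_const p) m = dp_const (Poly_Mapping.lookup p m)" for p :: "'a dpoly" and m
    by (simp add: Poly_Mapping.map.rep_eq when_def)
  show "Poly_Mapping.lookup (lin_F d n a L i) 0 = dp_var (i, 0) - dp_const (a i)"
    by (simp add: lin_F_def lookup_add map lookup_lin_H_0[OF assms])
  show "lin_coeff (lin_F d n a L i) v = dp_const (lin_coeff (lin_H d n L i) v)"
    unfolding lin_F_def lin_coeff_simps by (simp add: lin_coeff_def map)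
  have "Poly_Mapping.keys (Poly_Mapping.map dp_const p) \<subseteq> Poly_Mapping.keys p" for p :: "'a dpoly"
    by (auto simp: in_keys_iff map)
  then have "affine (Poly_Mapping.map dp_const (lin_H d n L i))"
    using affine_lin_H[OF assms, of n L i] unfolding affine_def by blast
  then show "affine (lin_F d n a L i)" unfolding lin_F_def by (intro affine_add affine_dp_const)
qed

text \<open>
  For \<open>\<gamma>\<^sub>j\<close> truncated to \<open>0\<close> this is the bound of \<open>l\<close> by the order of \<open>F\<^sub>i\<close>, otherwise it is the minimality of
  \<open>\<gamma>\<^sub>j\<close>.
\<close>

lemma gam_add_le_total_ord:
  assumes i: "i \<in> {1..n}" and l: "(j, l) \<in> dp_vars (F i)"
  shows "l + gam n F j \<le> total_ord (F i)"
proof -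
  have fin: "finite (dp_vars (F i) \<union> (\<Union>m\<in>Poly_Mapping.keys (F i). dp_vars (Poly_Mapping.lookup (F i) m)))"
    by simp
  have l_ord: "l \<le> total_ord (F i)"
    unfolding total_ord_def using fin l by (intro Max_ge finite_imageI) force+
  have "finite {k. (j, k) \<in> dp_vars (F i)}"
    by (rule finite_subset[OF _ finite_imageI[OF finite_dp_vars, of snd]]) force
  then have "int l \<le> dp_ord (F i) j" using l by (auto simp: dp_ord_def)
  moreover have "Min ((\<lambda>i. int (total_ord (F i)) - dp_ord (F i) j) ` {1..n}) \<le> int (total_ord (F i)) - dp_ord (F i) j"
    by (rule Min_le) (use i in auto)
  ultimately show ?thesis using l_ord unfolding gam_def by linarith
qed

text \<open>
  What can be said without deciding whether the complete resultant vanishes: the shape of the two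
  matrices, and membership of the resultant in the implicit ideal.
\<close>

locale linear_dppe =
  fixes d :: "'k::field \<Rightarrow> 'k" and n :: nat and a :: "nat \<Rightarrow> 'k" and L :: "nat \<Rightarrow> nat \<Rightarrow> 'k poly"
  assumes deriv: "derivation d" and n_pos: "n \<ge> 1"
    and standing: "\<And>j. j \<in> {1..n - 1} \<Longrightarrow> \<exists>i\<in>{1..n}. L i j \<noteq> 0"
    and sizes: "\<And>i. i \<in> {1..n} \<Longrightarrow>
      total_ord (lin_F d n a L i) + gam_sum n (lin_F d n a L) \<le> res_N n (lin_F d n a L)"
    and CResh_nonzero: "CResh d n (lin_F d n a L) (lin_H d n L) \<noteq> 0"
begin

abbreviation "F \<equiv> lin_F d n a L"
abbreviation "H \<equiv> lin_H d n L"

text \<open>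
  The complete resultant contains the derivatives of \<open>F\<^sub>i\<close> up to order \<open>m i\<close> and the variables \<open>u\<^sub>j\<^sub>l\<close>
  with \<open>l \<le> q j\<close>; the homogeneous one stops one step earlier.
\<close>

definition m :: "nat \<Rightarrow> nat" where "m i = res_N n F - total_ord (F i) - gam_sum n F"
definition q :: "nat \<Rightarrow> nat" where "q j = res_N n F - gam n F j - gam_sum n F"
definition h :: "nat \<times> nat \<Rightarrow> nat \<times> nat \<Rightarrow> 'k" where
  "h v w = lin_coeff ((dp_deriv d ^^ snd v) (H (fst v))) w"

lemma d_0: "d 0 = 0" by (rule derivation_0[OF deriv])

lemma coeff_L_bound:
  assumes "i \<in> {1..n}" "j \<in> {1..n - 1}" "poly.coeff (L i j) l \<noteq> 0"
  shows "l + gam n F j \<le> total_ord (F i)"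
proof (rule gam_add_le_total_ord[OF assms(1)])
  show "(j, l) \<in> dp_vars (F i)"
    unfolding dp_vars_affine[OF lookup_lin_F(3)[OF deriv]] lookup_lin_F(2)[OF deriv]
    using assms(2,3) by (simp add: lin_coeff_lin_H[OF deriv] dp_const_def)
      (metis lookup_single_eq lookup_zero)
qed

text \<open>
  Without this bound the truncated subtraction in \<open>q\<close> would miscount the columns. It needs an \<open>i\<close>
  with \<open>L i j \<noteq> 0\<close>.
\<close>

lemma gam_bound:
  assumes j: "j \<in> {1..n - 1}"
  shows "gam n F j + gam_sum n F \<le> res_N n F"
proof -
  obtain i where i: "i \<in> {1..n}" "L i j \<noteq> 0" using standing[OF j] by blast
  then have "poly.coeff (L i j) (degree (L i j)) \<noteq> 0" by simp
  from coeff_L_bound[OF i(1) j this] sizes[OF i(1)] show ?thesis by linarith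
qed

lemma h_eq: "h (i, k) = (shift_deriv d ^^ k) (lin_coeff (H i))"
  by (simp add: h_def fun_eq_iff dp_deriv_pow_affine(3)[where D = d, OF affine_lin_H[OF deriv] d_0])

text \<open>
  Names for the index sets keep the simplifier from rewriting \<open>1\<close> to \<open>Suc 0\<close> inside the constants of the
  staircase locale.
\<close>

definition X_ix :: "nat set" where "X_ix = {1..n}"
definition U_ix :: "nat set" where "U_ix = {1..n - 1}"

sublocale staircase_system d X_ix U_ix m q h
proof (unfold X_ix_def U_ix_def, unfold_locales)
  show "derivation d" by (rule deriv)
  show Suc: "h (i, Suc k) = shift_deriv d (h (i, k))" for i k by (simp add: h_eq)
  show "h (i, k) (j, l) = 0" if "i \<in> {1..n}" "j \<in> {1..n - 1}" "k + q j < l + m i" for i j k l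
    using that(3)
  proof (induction k arbitrary: l)
    case 0
    have "poly.coeff (L i j) l = 0"
      using coeff_L_bound[OF that(1,2), of l] sizes[OF that(1)] gam_bound[OF that(2)] 0
      unfolding m_def q_def by linarith
    then show ?case by (simp add: h_eq lin_coeff_lin_H[OF deriv])
  next
    case (Suc k)
    then show ?case by (cases l) (simp_all add: \<open>\<And>i k. h (i, Suc k) = _\<close> shift_deriv_simps d_0)
  qed
  show "h v (j, l) = 0" if "j \<notin> {1..n - 1}" for v j l
  proof -
    obtain i k where v: "v = (i, k)" by (cases v)
    have "h (i, k) (j, l) = 0"
    proof (induction k arbitrary: l)
      case 0 then show ?case using that by (auto simp: h_eq lin_coeff_lin_H[OF deriv])
    next
      case (Suc k)
      then show ?case by (cases l) (simp_all add: \<open>\<And>i k. h (i, Suc k) = _\<close> shift_deriv_simps d_0)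
    qed
    then show ?thesis by (simp add: v)
  qed
qed auto

abbreviation "row_list r \<equiv> row_index n (\<lambda>i. m i + r)"

lemma set_row_list: "set (row_list r) = rows r"
  unfolding rows_def by (simp add: set_row_index X_ix_def)

lemma set_col_list: "set (res_cols n F 0) = cols 1" "set (res_cols n F 1) = cols 0"
proof -
  have "k + gam n F j + gam_sum n F \<le> res_N n F \<longleftrightarrow> k < Suc (q j)"
    "Suc (k + gam n F j + gam_sum n F) \<le> res_N n F \<longleftrightarrow> k < q j" if "j \<in> {1..n - 1}" for j k
    using gam_bound[OF that] by (auto simp: q_def)
  then show "set (res_cols n F 0) = cols 1" "set (res_cols n F 1) = cols 0"
    unfolding cols_def unfolding set_res_cols U_ix_def by auto
qed

text \<open>
  Both sides are \<open>(n - 1) * N - n * \<gamma>\<close>: the orders \<open>o\<^sub>i\<close> add up to \<open>N\<close> and the \<open>\<gamma>\<^sub>j\<close> to \<open>\<gamma>\<close>.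
\<close>

lemma sum_m_eq_sum_q: "(\<Sum>i = 1..n. m i) = (\<Sum>j = 1..n - 1. q j)"
proof -
  have "(\<Sum>i = 1..n. m i + total_ord (F i) + gam_sum n F) = (\<Sum>i = 1..n. res_N n F)"
    by (intro sum.cong refl) (use sizes in \<open>fastforce simp: m_def\<close>)
  then have 1: "(\<Sum>i = 1..n. m i) + res_N n F + n * gam_sum n F = n * res_N n F"
    by (simp add: sum.distrib res_N_def)
  have "(\<Sum>j = 1..n - 1. q j + gam n F j + gam_sum n F) = (\<Sum>j = 1..n - 1. res_N n F)"
    by (intro sum.cong refl) (use gam_bound in \<open>fastforce simp: q_def\<close>)
  then have 2: "(\<Sum>j = 1..n - 1. q j) + gam_sum n F + (n - 1) * gam_sum n F = (n - 1) * res_N n F"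
    by (simp add: sum.distrib gam_sum_def)
  obtain n' where "n = Suc n'" using n_pos by (cases n) auto
  then show ?thesis using 1 2 by simp
qed

lemma lengths:
  "length (row_list 0) = CResh_size n F" "length (res_cols n F 1) = CResh_size n F"
  "length (row_list 1) = CRes_size n F" "CRes_size n F = Suc (length (res_cols n F 0))"
proof -
  show rows: "length (row_list 0) = CResh_size n F" "length (row_list 1) = CRes_size n F"
    by (simp_all add: length_row_index CRes_size_def CResh_size_def m_def)
  have cols: "length (res_cols n F 1) = (\<Sum>j = 1..n - 1. q j)" "length (res_cols n F 0) = (\<Sum>j = 1..n - 1. q j + 1)"
    unfolding distinct_card[OF distinct_res_cols, symmetric] set_col_list unfolding cols_def
    by (simp_all add: U_ix_def)
  show "length (res_cols n F 1) = CResh_size n F"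
    using rows(1) sum_m_eq_sum_q cols(1) by (simp add: length_row_index)
  have "(\<Sum>i = 1..n. m i + 1) = Suc (\<Sum>j = 1..n - 1. q j + 1)"
    unfolding sum.distrib using sum_m_eq_sum_q n_pos by simp
  then show "CRes_size n F = Suc (length (res_cols n F 0))"
    using rows(2) cols(2) by (simp add: length_row_index)
qed

lemma CResh_mat_eq:
  "CResh_mat d n F H = mat (CResh_size n F) (CResh_size n F)
     (\<lambda>(r, c). h (row_list 0 ! r) (res_cols n F 1 ! c))"
proof -
  have "CResh_rows d n F H = map (\<lambda>(i, k). (dp_deriv d ^^ k) (H i)) (row_list 0)"
    by (simp add: CResh_rows_eq m_def)
  then show ?thesis unfolding CResh_mat_def
    by (intro cong_mat) (auto simp: lengths(1)[simplified] h_def lin_coeff_def case_prod_beta)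
qed

text \<open>
  The three forms in which the nonvanishing of the homogeneous resultant is used.
\<close>

lemma small_system:
  "\<forall>w\<in>cols 0. combination (rows 0) y w = 0 \<Longrightarrow> \<forall>v\<in>rows 0. y v = 0"
  "\<exists>z. \<forall>w\<in>cols 0. combination (rows 0) z w = t w"
  "\<forall>v\<in>rows 0. (\<Sum>w\<in>cols 0. h v w * z w) = 0 \<Longrightarrow> \<forall>w\<in>cols 0. z w = 0"
proof -
  have det: "det (mat (CResh_size n F) (CResh_size n F) (\<lambda>(r, c). h (row_list 0 ! r) (res_cols n F 1 ! c))) \<noteq> 0"
    using CResh_nonzero by (simp add: CResh_def CResh_mat_eq)
  note dist = distinct_row_index[of n "\<lambda>i. m i + 0"] distinct_res_cols[of n F 1]
  show "\<forall>w\<in>cols 0. combination (rows 0) y w = 0 \<Longrightarrow> \<forall>v\<in>rows 0. y v = 0"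
    using det unfolding det_listed_eq_0_iff_row[OF dist(1) lengths(1,2)] set_row_list set_col_list combination_def
    by blast
  show "\<exists>z. \<forall>w\<in>cols 0. combination (rows 0) z w = t w"
    using det_listed_row_combination[OF dist lengths(1,2) det, of t]
    unfolding set_row_list set_col_list combination_def .
  show "\<forall>v\<in>rows 0. (\<Sum>w\<in>cols 0. h v w * z w) = 0 \<Longrightarrow> \<forall>w\<in>cols 0. z w = 0"
    using det unfolding det_listed_eq_0_iff_column[OF dist(2) lengths(1,2)] set_row_list set_col_list
    by blast
qed

definition \<alpha> :: "nat \<times> nat \<Rightarrow> 'k" where "\<alpha> v = (d ^^ snd v) (a (fst v))"

text \<open>
  The coefficients of the resultant as a linear form in the derivatives of the \<open>x\<^sub>i - a\<^sub>i\<close>.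
\<close>

definition \<kappa> :: "nat \<times> nat \<Rightarrow> 'k" where
  "\<kappa> v = (if v \<in> rows 1 then border_cofactor h (row_list 1) (res_cols n F 0) v else 0)"

lemma d_pow_uminus: "(d ^^ k) (- x) = - (d ^^ k) x"
  by (induction k) (simp_all add: derivation_minus[OF deriv])

lemma dp_deriv_pow_x:
  "(dp_deriv d ^^ k) (dp_var (i, 0) - dp_const (a i)) = dp_var (i, k) - dp_const (\<alpha> (i, k))"
proof -
  have aff: "affine (dp_var (i, 0) - dp_const (a i))" by (intro affine_diff) auto
  note deriv_pow = dp_deriv_pow_affine[where D = d and k = k, OF _ d_0]
  have "lin_coeff (dp_var (i, 0) - dp_const (a i)) = lin_coeff (dp_var (i, 0))" by (simp add: fun_eq_iff)
  then have "lin_coeff ((dp_deriv d ^^ k) (dp_var (i, 0) - dp_const (a i)))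
      = lin_coeff ((dp_deriv d ^^ k) (dp_var (i, 0)))"
    by (simp add: deriv_pow(3)[OF aff] deriv_pow(3)[OF affine_dp_var])
  also have "(dp_deriv d ^^ k) (dp_var (i, 0)) = dp_var (i, k)"
    by (simp add: dp_deriv_pow_dp_var[OF deriv])
  finally have lin: "lin_coeff ((dp_deriv d ^^ k) (dp_var (i, 0) - dp_const (a i))) = lin_coeff (dp_var (i, k))" .
  show ?thesis
  proof (rule affine_eqI)
    show "affine ((dp_deriv d ^^ k) (dp_var (i, 0) - dp_const (a i)))" by (rule deriv_pow(1)[OF aff])
    show "affine (dp_var (i, k) - dp_const (\<alpha> (i, k)))" by (intro affine_diff) auto
    show "Poly_Mapping.lookup ((dp_deriv d ^^ k) (dp_var (i, 0) - dp_const (a i))) 0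
        = Poly_Mapping.lookup (dp_var (i, k) - dp_const (\<alpha> (i, k))) 0"
      by (simp add: deriv_pow(2)[OF aff] lookup_minus d_pow_uminus \<alpha>_def)
  qed (simp add: lin)
qed

lemma F_deriv:
  "Poly_Mapping.lookup ((dp_deriv (dp_deriv d) ^^ k) (F i)) 0 = dp_var (i, k) - dp_const (\<alpha> (i, k))"
  "lin_coeff ((dp_deriv (dp_deriv d) ^^ k) (F i)) w = dp_const (h (i, k) w)"
proof -
  note deriv_pow = dp_deriv_pow_affine[where D = "dp_deriv d" and k = k, OF lookup_lin_F(3)[OF deriv, of n a L i] dp_deriv_0]
  show "Poly_Mapping.lookup ((dp_deriv (dp_deriv d) ^^ k) (F i)) 0 = dp_var (i, k) - dp_const (\<alpha> (i, k))"
    by (simp add: deriv_pow(2) lookup_lin_F(1)[OF deriv] dp_deriv_pow_x)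
  have const: "dp_deriv d (dp_const c) = dp_const (d c)" for c
    by (cases "c = 0") (simp_all add: dp_deriv_def dp_const_def d_0)
  have const_add: "dp_const (x + y) = dp_const x + dp_const y" for x y :: 'k
    by (simp add: dp_const_def single_add)
  have shift: "shift_deriv (dp_deriv d) (dp_const \<circ> f) = dp_const \<circ> shift_deriv d f" for f
    by (auto simp: fun_eq_iff shift_deriv_def const const_add split: nat.splits)
  have pow: "(shift_deriv (dp_deriv d) ^^ k) (dp_const \<circ> f) = dp_const \<circ> (shift_deriv d ^^ k) f" for f
    by (induction k) (simp_all add: shift[unfolded comp_def] comp_def)
  have "lin_coeff (F i) = dp_const \<circ> lin_coeff (H i)"
    by (simp add: fun_eq_iff lookup_lin_F(2)[OF deriv])
  then show "lin_coeff ((dp_deriv (dp_deriv d) ^^ k) (F i)) w = dp_const (h (i, k) w)"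
    by (simp add: deriv_pow(3) pow h_eq)
qed

text \<open>
  The columns of the \<open>u\<^sub>j\<^sub>l\<close> have entries in \<open>K\<close>; the indeterminates \<open>X\<close> occur in the last column only.
\<close>

lemma CRes_mat_eq:
  "CRes_mat d n F = bordered_mat dp_const h (\<lambda>v. dp_var v - dp_const (\<alpha> v)) (row_list 1) (res_cols n F 0)"
proof -
  have rows: "CRes_rows d n F = map (\<lambda>(i, k). (dp_deriv (dp_deriv d) ^^ k) (F i)) (row_list 1)"
    by (simp add: CRes_rows_eq m_def)
  have entry: "Poly_Mapping.lookup (CRes_rows d n F ! r)
      (if c < CRes_size n F - 1 then Poly_Mapping.single (res_cols n F 0 ! c) 1 else 0)
    = bordered dp_const h (\<lambda>v. dp_var v - dp_const (\<alpha> v)) (row_list 1 ! r) ((map Some (res_cols n F 0) @ [None]) ! c)"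
    if "r < CRes_size n F" "c < CRes_size n F" for r c
  proof -
    obtain i k where v: "row_list 1 ! r = (i, k)" by fastforce
    then have row: "CRes_rows d n F ! r = (dp_deriv (dp_deriv d) ^^ k) (F i)"
      using that(1) unfolding rows by (simp add: lengths(3)[simplified])
    show ?thesis
      using that(2) F_deriv unfolding row v
      by (auto simp: bordered_def lengths(4) nth_append lin_coeff_def)
  qed
  show ?thesis
    unfolding CRes_mat_def bordered_mat_def lengths(3)
    by (intro cong_mat) (simp_all add: entry[simplified])
qed

lemma CRes_eq: "CRes d n F = (\<Sum>v\<in>rows 1. dp_const (\<kappa> v) * (dp_var v - dp_const (\<alpha> v)))"
  unfolding CRes_def CRes_mat_eq
    det_bordered_mat[OF comm_ring_hom_dp_const distinct_row_index lengths(3)[unfolded lengths(4)]] set_row_list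
  by (intro sum.cong) (simp_all add: \<kappa>_def mult.commute)

lemma affine_CRes: "affine (CRes d n F)"
  unfolding CRes_eq by (intro affine_sum affine_dp_const_mult affine_diff) auto

lemma lin_coeff_CRes: "lin_coeff (CRes d n F) v = \<kappa> v"
proof (cases "v \<in> rows 1")
  case True
  then show ?thesis unfolding CRes_eq lin_coeff_simps by (simp add: sum_mult_indicator eq_commute[of v])
next
  case False
  then show ?thesis unfolding CRes_eq lin_coeff_simps by (auto simp: \<kappa>_def intro!: sum.neutral)
qed

lemma big_lists: "distinct (row_list 1)" "distinct (res_cols n F 0)" "length (row_list 1) = Suc (length (res_cols n F 0))"
  by (rule distinct_row_index distinct_res_cols lengths(3)[unfolded lengths(4)])+

lemma \<kappa>_relation: "\<kappa> \<in> relations 1"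
proof -
  have "combination (rows 1) \<kappa> w = 0" for w
  proof (cases "w \<in> cols 1")
    case True
    have "combination (rows 1) \<kappa> w
        = (\<Sum>v\<in>rows 1. border_cofactor h (row_list 1) (res_cols n F 0) v * h v w)"
      by (simp add: combination_def \<kappa>_def)
    then show ?thesis
      using border_cofactor_kills_columns[OF big_lists, of w] True unfolding set_row_list set_col_list by simp
  qed (rule combination_off_cols)
  then show ?thesis by (simp add: relations_def \<kappa>_def)
qed

end

text \<open>
  If \<open>q j = 0\<close> for some \<open>j\<close>, the homogeneous matrix has no column for \<open>u\<^sub>j\<close> and carries no information
  about the leading coefficients in \<open>u\<^sub>j\<close>; then the complete resultant is required to be nonzero.
\<close>

locale nondegenerate_linear_dppe = linear_dppe +
  assumes nondegenerate: "(\<forall>j\<in>{1..n - 1}. gam n (lin_F d n a L) j + gam_sum n (lin_F d n a L) < res_N n (lin_F d n a L))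
    \<or> CRes d n (lin_F d n a L) \<noteq> 0"
begin

lemma \<kappa>_nonzero: "\<exists>p. \<kappa> p \<noteq> 0"
  using nondegenerate
proof
  assume "CRes d n F \<noteq> 0"
  then show ?thesis unfolding CRes_eq by (metis (no_types, lifting) dp_const_0 mult_zero_left sum.neutral)
next
  assume small: "\<forall>j\<in>{1..n - 1}. gam n F j + gam_sum n F < res_N n F"
  have "\<exists>p\<in>set (row_list 1). border_cofactor h (row_list 1) (res_cols n F 0) p \<noteq> 0"
  proof (rule border_cofactor_nonzero[OF big_lists], unfold set_row_list set_col_list)
    fix z assume "\<forall>v\<in>rows 1. (\<Sum>u\<in>cols 1. h v u * z u) = 0"
    then show "\<forall>u\<in>cols 1. z u = 0"
      using small_system(3) small by (intro solution_eq_0_on_cols_1) (auto simp: q_def U_ix_def)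
  qed
  then show ?thesis unfolding set_row_list by (metis \<kappa>_def)
qed

sublocale staircase_syzygy d X_ix U_ix m q h \<kappa>
proof
  fix y assume y: "\<forall>w\<in>cols 1. combination (rows 1) y w = 0"
  obtain p where p: "\<kappa> p \<noteq> 0" using \<kappa>_nonzero by blast
  have "\<exists>e. \<forall>v\<in>set (row_list 1). y v = e * border_cofactor h (row_list 1) (res_cols n F 0) v"
  proof (rule left_kernel_border_cofactor[OF big_lists, of p])
    show "p \<in> set (row_list 1)" "border_cofactor h (row_list 1) (res_cols n F 0) p \<noteq> 0"
      using p unfolding set_row_list by (auto simp: \<kappa>_def split: if_splits)
    show "\<forall>u\<in>set (res_cols n F 0). (\<Sum>v\<in>set (row_list 1). y v * h v u) = 0"
      using y unfolding set_row_list set_col_list combination_def .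
  qed
  then show "\<exists>e. \<forall>v\<in>rows 1. y v = e * \<kappa> v" unfolding set_row_list by (simp add: \<kappa>_def)
qed (fact small_system(1) small_system(2) \<kappa>_relation)+

end

section \<open>The implicit equation\<close>

context linear_dppe
begin

text \<open>
  The images of the derivatives \<open>(i, k)\<close> of the \<open>x\<^sub>i\<close> under the parametrization.
\<close>

definition G :: "nat \<times> nat \<Rightarrow> 'k dpoly" where
  "G = (\<lambda>(i, k). (dp_deriv d ^^ k) (dp_const (a i) - H i))"

lemma G_affine: "affine (G v)"
  and lookup_G_0: "Poly_Mapping.lookup (G v) 0 = \<alpha> v"
  and lin_coeff_G: "lin_coeff (G v) w = - h v w"
proof -
  obtain i k where v: "v = (i, k)" by (cases v)
  have aff: "affine (dp_const (a i) - H i)" by (intro affine_diff affine_dp_const affine_lin_H[OF deriv])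
  note deriv_pow = dp_deriv_pow_affine[where D = d and k = k, OF aff d_0]
  show "affine (G v)" using deriv_pow(1) by (simp add: G_def v)
  show "Poly_Mapping.lookup (G v) 0 = \<alpha> v"
    using deriv_pow(2) by (simp add: G_def v lookup_minus lookup_lin_H_0[OF deriv] \<alpha>_def)
  have shift: "shift_deriv d (\<lambda>v. - f v) = (\<lambda>v. - shift_deriv d f v)" for f
    by (auto simp: fun_eq_iff shift_deriv_def derivation_minus[OF deriv] split: nat.splits)
  have pow: "(shift_deriv d ^^ k) (\<lambda>v. - f v) = (\<lambda>v. - (shift_deriv d ^^ k) f v)" for f
    by (induction k) (simp_all add: shift)
  have "lin_coeff (dp_const (a i) - H i) = (\<lambda>v. - lin_coeff (H i) v)" by (simp add: fun_eq_iff)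
  then show "lin_coeff (G v) w = - h v w"
    using deriv_pow(3) by (simp add: G_def v pow h_eq)
qed

definition ID :: "'k dpoly set" where "ID = implicit_ideal d n (\<lambda>i. dp_const (a i) - H i)"

lemma mem_ID: "f \<in> ID \<longleftrightarrow> f \<in> dpolys {1..n} \<and> dp_eval dp_const G f = 0"
  by (simp add: ID_def implicit_ideal_def dp_subst_eq_dp_eval G_def)

lemma CRes_dpolys: "CRes d n F \<in> dpolys {1..n}"
proof -
  have "w \<in> {1..n} \<times> UNIV" if "w \<in> dp_vars (CRes d n F)" for w
  proof -
    have "w \<in> rows 1" using that by (simp add: dp_vars_affine[OF affine_CRes] lin_coeff_CRes \<kappa>_def split: if_splits)
    then show ?thesis unfolding rows_def unfolding X_ix_def by auto
  qed
  then show ?thesis by (auto simp: dpolys_def)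
qed

text \<open>
  The substitution turns \<open>\<partial>\<^sup>k (x\<^sub>i - a\<^sub>i)\<close> into \<open>- \<partial>\<^sup>k H\<^sub>i\<close>, and \<open>\<kappa>\<close> is a relation between these.
\<close>

lemma CRes_mem_ID: "CRes d n F \<in> ID"
proof -
  interpret E: evaluation "dp_const :: 'k \<Rightarrow> 'k dpoly" G
    using comm_ring_hom_dp_const by (simp add: evaluation_def)
  interpret ev: comm_ring_hom E.ev by (rule E.comm_ring_hom_ev)
  have "E.ev (CRes d n F) = (\<Sum>v\<in>rows 1. dp_const (\<kappa> v) * (G v - dp_const (\<alpha> v)))"
    unfolding CRes_eq by (simp add: hom_distribs)
  also have "\<dots> = 0"
  proof (rule affine_eqI)
    show "affine (\<Sum>v\<in>rows 1. dp_const (\<kappa> v) * (G v - dp_const (\<alpha> v)))"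
      by (intro affine_sum affine_dp_const_mult affine_diff G_affine affine_dp_const)
    show "Poly_Mapping.lookup (\<Sum>v\<in>rows 1. dp_const (\<kappa> v) * (G v - dp_const (\<alpha> v))) 0
        = Poly_Mapping.lookup (0 :: 'k dpoly) 0"
      by (simp add: lookup_sum lookup_dp_const_mult lookup_minus lookup_G_0)
    fix w
    have "combination (rows 1) \<kappa> w = 0" using \<kappa>_relation unfolding relations_def by blast
    then show "lin_coeff (\<Sum>v\<in>rows 1. dp_const (\<kappa> v) * (G v - dp_const (\<alpha> v))) w = lin_coeff (0 :: 'k dpoly) w"
      unfolding lin_coeff_simps by (simp add: lin_coeff_G combination_def sum_negf)
  qed simp
  finally show ?thesis using CRes_dpolys by (simp add: mem_ID)
qed

end

context nondegenerate_linear_dppe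
begin

text \<open>
  A linear dependency among the images of the derivatives outside the tail \<open>(i, k')\<close>, \<open>k' \<ge> k\<close>, would
  be a relation that avoids the tail of \<open>\<kappa>\<close>.
\<close>

lemma ID_avoiding_tail_eq_0:
  assumes lead: "(i, k) \<in> dp_vars (CRes d n F)" "\<forall>k'>k. (i, k') \<notin> dp_vars (CRes d n F)"
    and f: "f \<in> ID" "\<forall>k'\<ge>k. (i, k') \<notin> dp_vars f"
  shows "f = 0"
proof -
  define T where "T = {1..n} \<times> UNIV - {i} \<times> {k..}"
  show ?thesis
  proof (rule dp_eval_affine_injective[of T G f])
    show "affine (G v)" for v by (rule G_affine)
    show "dp_vars f \<subseteq> T" using f by (auto simp: T_def mem_ID dpolys_def)
    show "dp_eval dp_const G f = 0" using f by (simp add: mem_ID)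
    fix S y assume S: "finite S" "S \<subseteq> T" and zero: "\<And>w. (\<Sum>v\<in>S. y v * lin_coeff (G v) w) = 0"
    define y' where "y' v = (if v \<in> S then y v else 0)" for v
    define r where "r = Suc (Max (insert 0 (snd ` S)))"
    have S_rows: "S \<subseteq> rows r"
    proof
      fix v assume v: "v \<in> S"
      have "snd v \<le> Max (insert 0 (snd ` S))" using S(1) v by (intro Max_ge) auto
      then show "v \<in> rows r" using v S(2) unfolding rows_def unfolding X_ix_def T_def r_def by (cases v) auto
    qed
    have "combination (rows r) y' w = 0" for w
    proof -
      have "combination (rows r) y' w = combination S y' w"
        by (rule combination_superset[OF S_rows]) (auto simp: y'_def)
      also have "\<dots> = (\<Sum>v\<in>S. y v * h v w)" by (simp add: combination_def y'_def)
      also have "\<dots> = - (\<Sum>v\<in>S. y v * lin_coeff (G v) w)" by (simp add: lin_coeff_G sum_negf)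
      finally show ?thesis by (simp add: zero)
    qed
    then have "y' \<in> relations r" using S_rows by (auto simp: relations_def y'_def)
    then have "y' v = 0" for v
    proof (rule relation_avoiding_tail_eq_0[rotated 2])
      show "\<kappa> (i, k) \<noteq> 0" "\<And>k'. k < k' \<Longrightarrow> \<kappa> (i, k') = 0"
        using lead by (simp_all add: dp_vars_affine[OF affine_CRes] lin_coeff_CRes)
      show "y' (i, k') = 0" if "k \<le> k'" for k' using that S(2) by (auto simp: y'_def T_def)
    qed
    then show "\<forall>v\<in>S. y v = 0" unfolding y'_def by metis
  qed
qed

lemma dp_vars_CRes: "dp_vars (CRes d n F) \<noteq> {}"
  using \<kappa>_nonzero by (auto simp: dp_vars_affine[OF affine_CRes] lin_coeff_CRes)

lemma ID_subset: "ID \<subseteq> dpolys {1..n}" by (auto simp: mem_ID)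

lemma characteristic_set_CRes: "ranking n lt \<Longrightarrow> characteristic_set lt ID {CRes d n F}"
  by (rule characteristic_set_singleton[OF _ ID_subset CRes_mem_ID affine_CRes dp_vars_CRes])
    (use ID_avoiding_tail_eq_0 in blast)+

lemma implicit_equation:
  "has_diff_dim n ID (n - 1)" "characteristic_polynomial n ID (CRes d n F)"
proof -
  show "has_diff_dim n ID (n - 1)"
    using n_pos ID_subset characteristic_set_CRes by (rule has_diff_dim_singleton)
  obtain v where "\<kappa> v \<noteq> 0" using \<kappa>_nonzero by blast
  then have "irreducible (CRes d n F)"
    by (intro irreducible_affine[OF affine_CRes]) (simp add: lin_coeff_CRes)
  then show "characteristic_polynomial n ID (CRes d n F)"
    using CRes_dpolys characteristic_set_CRes by (simp add: characteristic_polynomial_def)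
qed

end

text \<open>
  The system determines the \<open>P\<^sub>i\<close> for indices \<open>1..n\<close> only.
\<close>

lemma implicit_ideal_cong:
  assumes "\<And>i. i \<in> {1..n} \<Longrightarrow> P i = Q i"
  shows "implicit_ideal d n P = implicit_ideal d n Q"
proof -
  have "dp_subst d P f = dp_subst d Q f" if f: "f \<in> dpolys {1..n}" for f
    unfolding dp_subst_eq_dp_eval
    by (rule dp_eval_cong) (use dpolys_index[OF f] assms in \<open>force split: prod.splits\<close>)
  then show ?thesis by (auto simp: implicit_ideal_def)
qed

theorem theorem6p3:
  fixes d :: "'k::field \<Rightarrow> 'k"
    and n :: nat
    and P :: "nat \<Rightarrow> 'k dpoly"
    and a :: "nat \<Rightarrow> 'k"
    and L :: "nat \<Rightarrow> nat \<Rightarrow> 'k poly"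
    and H :: "nat \<Rightarrow> 'k dpoly"
    and F :: "nat \<Rightarrow> 'k dpoly dpoly"
  defines "H \<equiv> lin_H d n L"
    and "F \<equiv> lin_F d n a L"
  assumes "derivation d"
    and "n \<ge> 2"
    and system: "\<forall>i\<in>{1..n}. P i =
          dp_const (a i) - (\<Sum>j = 1..n - 1. dop_apply d (L i j) (dp_var (j, 0)))"
    and "\<exists>i\<in>{1..n}. P i \<notin> dpolys {}"
    and standing: "\<forall>j\<in>{1..n - 1}. \<exists>i\<in>{1..n}. L i j \<noteq> 0"
    and matrices_defined: "\<forall>i\<in>{1..n}. total_ord (F i) + gam_sum n F \<le> res_N n F"
    and nondegenerate: "(\<forall>j\<in>{1..n - 1}. gam n F j + gam_sum n F < res_N n F) \<or> CRes d n F \<noteq> 0"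
    and "CResh d n F H \<noteq> 0"
  shows "has_diff_dim n (implicit_ideal d n P) (n - 1) \<and>
         characteristic_polynomial n (implicit_ideal d n P) (CRes d n F)"
proof -
  interpret S: nondegenerate_linear_dppe d n a L
    by unfold_locales (use assms in auto)
  have "implicit_ideal d n P = S.ID"
    unfolding S.ID_def by (rule implicit_ideal_cong) (use system in \<open>simp add: lin_H_def\<close>)
  then show ?thesis using S.implicit_equation by (simp add: F_def)
qed

end
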